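(* Let $\Gamma$ be a metric graph, let $D$ be an effective divisor on $\Gamma$, and let $E$ be the set of connected components of $\Gamma\smallsetminus\mathrm{supp}(D)$. Let $\Sigma\subseteq R(D)$ be a tropical linear series of dimension $r$ with big minimizers. Then \[\{F_\varphi:\varphi\in\Sigma\}\cup\{E\}\] is the lattice of flats of a matroid $M_\Sigma$ of rank $r+1$ on $E$, and $M_\Sigma$ is loopless if and only if $D\in|\Sigma|$.
   Context: A metric graph is the metric space of a finite connected graph (loops and multiple edges allowed) with positive real edge lengths. A divisor $D$ is a finite formal $\mathbb Z$-combination of points; it is effective ($\ge0$) if all coefficients are nonnegative; $\mathrm{supp}(D)$ is the set of points with nonzero coefficient. $\mathrm{PL}(\Gamma)$ is the set of continuous piecewise-linear functions with integer slopes; $\mathrm{div}(\varphi)$ is the divisor whose multiplicity at $p$ is the sum of the incoming slopes (minus the sum of the outgoing slopes) of $\varphi$ at $p$; $R(D)=\{\varphi\in\mathrm{PL}(\Gamma):D+\mathrm{div}(\varphi)\ge0\}$. A tropical submodule of $R(D)$ is a subset closed under pointwise minimum and addition of real constants (a zero element $\infty$ is tacitly adjoined); it is finitely generated if it is the set of all finite tropical linear combinations $\min_i\{\varphi_i+a_i\}$ of a finite set of elements. $r_{\mathrm{BN}}(\Sigma)$ is the largest integer $r$ such that for every effective divisor $D'$ of degree $r$ there is $\varphi\in\Sigma$ with $D-D'+\mathrm{div}(\varphi)\ge0$. A finite set $\{\varphi_0,\dots,\varphi_s\}$ is tropically dependent if there are reals $a_i$ such that at every point of $\Gamma$ the minimum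 $\min_i\{\varphi_i+a_i\}$ is achieved at least twice, and independent otherwise; $r_{\mathrm{ind}}(\Sigma)$ is the size of the largest tropically independent subset. A tropical linear series of dimension $r$ is a finitely generated $\Sigma\subseteq R(D)$ with $r_{\mathrm{BN}}(\Sigma)=r$ and $r_{\mathrm{ind}}(\Sigma)=r+1$. $|\Sigma|=\{D+\mathrm{div}(\varphi):\varphi\in\Sigma\}$. For $\varphi\in R(D)$, $\varphi_{\min}=\{p\in\Gamma:\varphi(p)=\min_\Gamma\varphi\}$ and $F_\varphi=\{S\in E:S\not\subseteq\varphi_{\min}\}$. A tropical submodule $\Sigma\subseteq R(D)$ has big minimizers if for every $\varphi\in\Sigma$ the set $\varphi_{\min}$ contains some $S\in E$. *)

theory Defs
  imports "Graph_Theory.Digraph_Component" "HOL-Library.Extended_Nat" "HOL-Analysis.Analysis"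
begin

section \<open>Metric graphs\<close>

text \<open>
  A metric graph is presented by a finite connected graph with positive edge lengths. The graph is
  a finite multidigraph (loops and multiple edges allowed); the orientation of an edge \<open>e\<close> only
  serves to parametrize it by the interval from \<open>0\<close> (at the tail) to the length of \<open>e\<close> (at the head),
  and connectedness ignores it.
\<close>

record ('v, 'e) mgraph =
  graph :: "('v, 'e) pre_digraph"
  len :: "'e \<Rightarrow> real"

abbreviation edges :: "('v, 'e) mgraph \<Rightarrow> 'e set" where
  "edges \<Gamma> \<equiv> arcs (graph \<Gamma>)"

definition metric_graph :: "('v, 'e) mgraph \<Rightarrow> bool" where
  "metric_graph \<Gamma> \<longleftrightarrow>
     fin_digraph (graph \<Gamma>) \<and> Digraph_Component.connected (graph \<Gamma>) \<and> (\<forall>e\<in>edges \<Gamma>. 0 < len \<Gamma> e)"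

datatype ('v, 'e) gpoint = Vertex 'v | Inner 'e real

definition points :: "('v, 'e) mgraph \<Rightarrow> ('v, 'e) gpoint set" where
  "points \<Gamma> = Vertex ` verts (graph \<Gamma>) \<union> {Inner e t | e t. e \<in> edges \<Gamma> \<and> 0 < t \<and> t < len \<Gamma> e}"

definition edge_pt :: "('v, 'e) mgraph \<Rightarrow> 'e \<Rightarrow> real \<Rightarrow> ('v, 'e) gpoint" where
  "edge_pt \<Gamma> e t =
     (if t \<le> 0 then Vertex (tail (graph \<Gamma>) e)
      else if len \<Gamma> e \<le> t then Vertex (head (graph \<Gamma>) e)
      else Inner e t)"

text \<open>
  \<open>path_length \<Gamma> x y l\<close>: there is a path of total length \<open>l\<close> from \<open>x\<close> to \<open>y\<close> that is a concatenation
  of finitely many segments, each contained in a closed edge.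
\<close>

inductive path_length ::
  "('v, 'e) mgraph \<Rightarrow> ('v, 'e) gpoint \<Rightarrow> ('v, 'e) gpoint \<Rightarrow> real \<Rightarrow> bool" for \<Gamma> where
  refl: "x \<in> points \<Gamma> \<Longrightarrow> path_length \<Gamma> x x 0"
| step: "\<lbrakk>path_length \<Gamma> x (edge_pt \<Gamma> e s) l; e \<in> edges \<Gamma>; s \<in> {0..len \<Gamma> e}; t \<in> {0..len \<Gamma> e}\<rbrakk>
    \<Longrightarrow> path_length \<Gamma> x (edge_pt \<Gamma> e t) (l + \<bar>t - s\<bar>)"

definition gdist :: "('v, 'e) mgraph \<Rightarrow> ('v, 'e) gpoint \<Rightarrow> ('v, 'e) gpoint \<Rightarrow> real" where
  "gdist \<Gamma> x y = (if x \<in> points \<Gamma> \<and> y \<in> points \<Gamma> then Inf {l. path_length \<Gamma> x y l} else 0)"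

lemma metric_graphD:
  assumes "metric_graph \<Gamma>"
  shows "finite (verts (graph \<Gamma>))" "finite (edges \<Gamma>)" "e \<in> edges \<Gamma> \<Longrightarrow> 0 < len \<Gamma> e"
    "e \<in> edges \<Gamma> \<Longrightarrow> tail (graph \<Gamma>) e \<in> verts (graph \<Gamma>)"
    "e \<in> edges \<Gamma> \<Longrightarrow> head (graph \<Gamma>) e \<in> verts (graph \<Gamma>)"
proof -
  interpret fin_digraph "graph \<Gamma>" using assms by (simp add: metric_graph_def)
  show "finite (verts (graph \<Gamma>))" "finite (edges \<Gamma>)" "e \<in> edges \<Gamma> \<Longrightarrow> 0 < len \<Gamma> e"
    "e \<in> edges \<Gamma> \<Longrightarrow> tail (graph \<Gamma>) e \<in> verts (graph \<Gamma>)"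
    "e \<in> edges \<Gamma> \<Longrightarrow> head (graph \<Gamma>) e \<in> verts (graph \<Gamma>)"
    using assms by (auto simp: metric_graph_def)
qed

lemma edge_pt_in_points:
  assumes "metric_graph \<Gamma>" "e \<in> edges \<Gamma>"
  shows "edge_pt \<Gamma> e t \<in> points \<Gamma>"
  using metric_graphD[OF assms(1)] assms(2) by (auto simp: points_def edge_pt_def)

lemma path_length_nonneg: "path_length \<Gamma> x y l \<Longrightarrow> 0 \<le> l"
  by (induction rule: path_length.induct) auto

lemma path_length_trans:
  assumes "path_length \<Gamma> y z m" "path_length \<Gamma> x y l"
  shows "path_length \<Gamma> x z (l + m)"
  using assms
proof (induction rule: path_length.induct)
  case (step y e s m t)
  from path_length.step[OF step.IH[OF step.prems] step.hyps(2-4)]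
  show ?case by (simp add: add.assoc)
qed simp

lemma path_length_segment:
  assumes "metric_graph \<Gamma>" "e \<in> edges \<Gamma>" "s \<in> {0..len \<Gamma> e}" "t \<in> {0..len \<Gamma> e}"
  shows "path_length \<Gamma> (edge_pt \<Gamma> e s) (edge_pt \<Gamma> e t) \<bar>t - s\<bar>"
  using path_length.step[OF path_length.refl[OF edge_pt_in_points[OF assms(1,2)]] assms(2-4)] by simp

lemma path_length_sym:
  assumes "path_length \<Gamma> x y l" "metric_graph \<Gamma>"
  shows "path_length \<Gamma> y x l"
  using assms
proof (induction rule: path_length.induct)
  case (step x e s l t)
  from path_length_trans[OF step.IH[OF step.prems] path_length_segment[OF step.prems step.hyps(2,4,3)]]
  show ?case by (simp add: abs_minus_commute add.commute)
qed (auto intro: path_length.refl)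

lemma path_length_vertices:
  assumes "metric_graph \<Gamma>" "u \<in> verts (graph \<Gamma>)" "v \<in> verts (graph \<Gamma>)"
  shows "\<exists>l. path_length \<Gamma> (Vertex u) (Vertex v) l"
proof -
  have "(u, v) \<in> rtrancl_on (verts (graph \<Gamma>)) (parcs (mk_symmetric (graph \<Gamma>)))"
    using assms unfolding metric_graph_def Digraph_Component.connected_def strongly_connected_def
      reachable_def by simp
  then show ?thesis
  proof (induction rule: rtrancl_on_induct)
    case base
    have "Vertex u \<in> points \<Gamma>" using assms(2) by (simp add: points_def)
    then show ?case using path_length.refl by blast
  next
    case (step y z)
    then obtain l where l: "path_length \<Gamma> (Vertex u) (Vertex y) l" by blast
    from step.hyps obtain e where e: "e \<in> edges \<Gamma>"
      "y = tail (graph \<Gamma>) e \<and> z = head (graph \<Gamma>) e \<or> y = head (graph \<Gamma>) e \<and> z = tail (graph \<Gamma>) e"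
      by (auto simp: parcs_mk_symmetric)
    have pos: "0 < len \<Gamma> e" using metric_graphD(3)[OF assms(1) e(1)] .
    have ends: "edge_pt \<Gamma> e 0 = Vertex (tail (graph \<Gamma>) e)"
      "edge_pt \<Gamma> e (len \<Gamma> e) = Vertex (head (graph \<Gamma>) e)" using pos by (auto simp: edge_pt_def)
    have "path_length \<Gamma> (Vertex (tail (graph \<Gamma>) e)) (Vertex (head (graph \<Gamma>) e)) (len \<Gamma> e)"
      using path_length_segment[OF assms(1) e(1), of 0 "len \<Gamma> e"] pos ends by simp
    then have "path_length \<Gamma> (Vertex y) (Vertex z) (len \<Gamma> e)"
      using e(2) path_length_sym assms(1) by blast
    then show ?case using path_length_trans l by blast
  qed
qed

lemma path_length_ex:
  assumes "metric_graph \<Gamma>" "x \<in> points \<Gamma>" "y \<in> points \<Gamma>"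
  shows "\<exists>l. path_length \<Gamma> x y l"
proof -
  have vertex: "\<exists>v l. v \<in> verts (graph \<Gamma>) \<and> path_length \<Gamma> x (Vertex v) l" if x: "x \<in> points \<Gamma>" for x
  proof (cases x)
    case (Vertex v)
    then show ?thesis using x path_length.refl[OF x] by (auto simp: points_def)
  next
    case (Inner e t)
    then have e: "e \<in> edges \<Gamma>" "0 < t" "t < len \<Gamma> e" using x by (auto simp: points_def)
    have "path_length \<Gamma> (edge_pt \<Gamma> e t) (edge_pt \<Gamma> e 0) \<bar>0 - t\<bar>"
      using e by (intro path_length_segment assms) auto
    moreover have "edge_pt \<Gamma> e t = x" "edge_pt \<Gamma> e 0 = Vertex (tail (graph \<Gamma>) e)"
      using e Inner by (auto simp: edge_pt_def)
    ultimately show ?thesis using metric_graphD(4)[OF assms(1) e(1)] by auto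
  qed
  from vertex[OF assms(2)] vertex[OF assms(3)] path_length_vertices[OF assms(1)]
  show ?thesis by (meson assms(1) path_length_sym path_length_trans)
qed

lemma path_length_ge_lipschitz:
  fixes f :: "('v, 'e) gpoint \<Rightarrow> real"
  assumes "path_length \<Gamma> x y l"
    and "\<And>e s t. \<lbrakk>e \<in> edges \<Gamma>; s \<in> {0..len \<Gamma> e}; t \<in> {0..len \<Gamma> e}\<rbrakk>
      \<Longrightarrow> \<bar>f (edge_pt \<Gamma> e t) - f (edge_pt \<Gamma> e s)\<bar> \<le> \<bar>t - s\<bar>"
  shows "\<bar>f y - f x\<bar> \<le> l"
  using assms(1)
proof (induction rule: path_length.induct)
  case (step x e s l t)
  then show ?case using assms(2)[of e s t] by fastforce
qed simp

lemma separate_inner: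
  assumes \<Gamma>: "metric_graph \<Gamma>" and x: "Inner e0 t0 \<in> points \<Gamma>" and "Inner e0 t0 \<noteq> y"
  shows "\<exists>f::('v, 'e) gpoint \<Rightarrow> real. f (Inner e0 t0) \<noteq> f y \<and>
    (\<forall>e\<in>edges \<Gamma>. \<forall>s\<in>{0..len \<Gamma> e}. \<forall>t\<in>{0..len \<Gamma> e}.
      \<bar>f (edge_pt \<Gamma> e t) - f (edge_pt \<Gamma> e s)\<bar> \<le> \<bar>t - s\<bar>)"
proof -
  define r where "r = min t0 (len \<Gamma> e0 - t0)"
  define f :: "('v, 'e) gpoint \<Rightarrow> real" where
    "f p = (case p of Vertex v \<Rightarrow> 0 | Inner e t \<Rightarrow> if e = e0 then max 0 (r - \<bar>t - t0\<bar>) else 0)" for p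
  have r: "0 < r" using x by (auto simp: r_def points_def)
  have f0: "f (edge_pt \<Gamma> e t) = 0" if "e \<noteq> e0" for e t
    using that by (auto simp: f_def edge_pt_def)
  have f1: "f (edge_pt \<Gamma> e0 t) = max 0 (r - \<bar>t - t0\<bar>)" if "t \<in> {0..len \<Gamma> e0}" for t
    using that by (auto simp: f_def edge_pt_def r_def)
  have "f (Inner e0 t0) \<noteq> f y"
    using r assms(3) by (cases y) (auto simp: f_def)
  moreover have "\<bar>f (edge_pt \<Gamma> e t) - f (edge_pt \<Gamma> e s)\<bar> \<le> \<bar>t - s\<bar>"
    if "e \<in> edges \<Gamma>" "s \<in> {0..len \<Gamma> e}" "t \<in> {0..len \<Gamma> e}" for e s t
  proof (cases "e = e0")
    case True
    then show ?thesis using f1[of s] f1[of t] that by (auto simp: max_def)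
  qed (simp add: f0)
  ultimately show ?thesis by blast
qed

lemma separate_vertex:
  assumes \<Gamma>: "metric_graph \<Gamma>" and "v \<noteq> w"
  shows "\<exists>f::('v, 'e) gpoint \<Rightarrow> real. f (Vertex v) \<noteq> f (Vertex w) \<and>
    (\<forall>e\<in>edges \<Gamma>. \<forall>s\<in>{0..len \<Gamma> e}. \<forall>t\<in>{0..len \<Gamma> e}.
      \<bar>f (edge_pt \<Gamma> e t) - f (edge_pt \<Gamma> e s)\<bar> \<le> \<bar>t - s\<bar>)"
proof -
  define m where "m = Min (insert 1 (len \<Gamma> ` edges \<Gamma>))"
  have m: "0 < m" "\<And>e. e \<in> edges \<Gamma> \<Longrightarrow> m \<le> len \<Gamma> e"
    using metric_graphD[OF \<Gamma>] by (auto simp: m_def Min_gr_iff)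
  define g where "g u = (if u = v then 0 else m)" for u
  define a where "a e = g (tail (graph \<Gamma>) e)" for e
  define c where "c e = (g (head (graph \<Gamma>) e) - g (tail (graph \<Gamma>) e)) / len \<Gamma> e" for e
  define f :: "('v, 'e) gpoint \<Rightarrow> real" where
    "f p = (case p of Vertex u \<Rightarrow> g u | Inner e t \<Rightarrow> a e + c e * t)" for p
  have f1: "f (edge_pt \<Gamma> e t) = a e + c e * t" if "e \<in> edges \<Gamma>" "t \<in> {0..len \<Gamma> e}" for e t
    using that metric_graphD(3)[OF \<Gamma> that(1)] by (auto simp: f_def edge_pt_def a_def c_def)
  have c1: "\<bar>c e\<bar> \<le> 1" if "e \<in> edges \<Gamma>" for e
    using m(1) m(2)[OF that] metric_graphD(3)[OF \<Gamma> that] by (auto simp: c_def g_def)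
  have "\<bar>f (edge_pt \<Gamma> e t) - f (edge_pt \<Gamma> e s)\<bar> \<le> \<bar>t - s\<bar>"
    if "e \<in> edges \<Gamma>" "s \<in> {0..len \<Gamma> e}" "t \<in> {0..len \<Gamma> e}" for e s t
  proof -
    have "f (edge_pt \<Gamma> e t) - f (edge_pt \<Gamma> e s) = c e * (t - s)"
      using f1 that by (simp add: algebra_simps)
    then have "\<bar>f (edge_pt \<Gamma> e t) - f (edge_pt \<Gamma> e s)\<bar> = \<bar>c e\<bar> * \<bar>t - s\<bar>"
      by (simp add: abs_mult)
    also have "\<dots> \<le> \<bar>t - s\<bar>" using c1[OF that(1)] by (simp add: mult_left_le_one_le)
    finally show ?thesis .
  qed
  moreover have "f (Vertex v) \<noteq> f (Vertex w)" using m(1) \<open>v \<noteq> w\<close> by (simp add: f_def g_def)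
  ultimately show ?thesis by blast
qed

lemma path_length_lower_bound:
  assumes \<Gamma>: "metric_graph \<Gamma>" and "x \<in> points \<Gamma>" "y \<in> points \<Gamma>" "x \<noteq> y"
  shows "\<exists>\<epsilon>>0. \<forall>l. path_length \<Gamma> x y l \<longrightarrow> \<epsilon> \<le> l"
proof -
  obtain f :: "('a, 'b) gpoint \<Rightarrow> real" where f: "f x \<noteq> f y"
    "\<forall>e\<in>edges \<Gamma>. \<forall>s\<in>{0..len \<Gamma> e}. \<forall>t\<in>{0..len \<Gamma> e}.
      \<bar>f (edge_pt \<Gamma> e t) - f (edge_pt \<Gamma> e s)\<bar> \<le> \<bar>t - s\<bar>"
  proof (cases x)
    case Inner
    then show ?thesis using separate_inner[OF \<Gamma>, of _ _ y] assms that by metis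
  next
    case v: (Vertex v)
    show ?thesis
    proof (cases y)
      case Inner
      then show ?thesis using separate_inner[OF \<Gamma>, of _ _ x] assms that by metis
    next
      case (Vertex w)
      then show ?thesis using separate_vertex[OF \<Gamma>, of v w] assms that v by metis
    qed
  qed
  show ?thesis
  proof (intro exI conjI allI impI)
    show "0 < \<bar>f y - f x\<bar>" using f(1) by simp
    show "\<bar>f y - f x\<bar> \<le> l" if "path_length \<Gamma> x y l" for l
      using path_length_ge_lipschitz[OF that, of f] f(2) by blast
  qed
qed

lemma Metric_space_gdist:
  assumes \<Gamma>: "metric_graph \<Gamma>"
  shows "Metric_space (points \<Gamma>) (gdist \<Gamma>)"
proof
  fix x y z
  have bdd: "bdd_below {l. path_length \<Gamma> x y l}" for x y
    using path_length_nonneg by (intro bdd_belowI[of _ 0]) auto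
  show "0 \<le> gdist \<Gamma> x y"
    using path_length_ex[OF \<Gamma>, of x y] path_length_nonneg
    by (auto simp: gdist_def intro!: cInf_greatest)
  have "{l. path_length \<Gamma> x y l} = {l. path_length \<Gamma> y x l}" using path_length_sym[OF _ \<Gamma>] by blast
  then show "gdist \<Gamma> x y = gdist \<Gamma> y x" by (simp add: gdist_def)
  assume xy: "x \<in> points \<Gamma>" "y \<in> points \<Gamma>"
  show "gdist \<Gamma> x y = 0 \<longleftrightarrow> x = y"
  proof
    assume "gdist \<Gamma> x y = 0"
    then have 0: "Inf {l. path_length \<Gamma> x y l} = 0" using xy by (simp add: gdist_def)
    show "x = y"
    proof (rule ccontr)
      assume "x \<noteq> y"
      then obtain \<epsilon> where "0 < \<epsilon>" "\<forall>l. path_length \<Gamma> x y l \<longrightarrow> \<epsilon> \<le> l"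
        using path_length_lower_bound[OF \<Gamma> xy] by blast
      moreover from this have "\<epsilon> \<le> Inf {l. path_length \<Gamma> x y l}"
        using path_length_ex[OF \<Gamma> xy] by (intro cInf_greatest) auto
      ultimately show False using 0 by simp
    qed
  next
    assume "x = y"
    moreover have "Inf {l. path_length \<Gamma> x x l} = 0"
      using path_length.refl[OF xy(1)] path_length_nonneg by (intro cInf_eq_minimum) auto
    ultimately show "gdist \<Gamma> x y = 0" using xy by (simp add: gdist_def)
  qed
  assume z: "z \<in> points \<Gamma>"
  have "gdist \<Gamma> x z - l \<le> gdist \<Gamma> y z" if l: "path_length \<Gamma> x y l" for l
  proof -
    have "gdist \<Gamma> x z - l \<le> m" if "path_length \<Gamma> y z m" for m
      using cInf_lower[OF _ bdd, of "l + m" x z] path_length_trans[OF that l] xy z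
      by (simp add: gdist_def)
    then show ?thesis using path_length_ex[OF \<Gamma> xy(2) z] xy z
      by (auto simp: gdist_def[of _ y] intro!: cInf_greatest)
  qed
  then have "gdist \<Gamma> x z - gdist \<Gamma> y z \<le> l" if "path_length \<Gamma> x y l" for l using that by force
  then have "gdist \<Gamma> x z - gdist \<Gamma> y z \<le> gdist \<Gamma> x y"
    using path_length_ex[OF \<Gamma> xy] xy by (auto simp: gdist_def[of _ x y] intro!: cInf_greatest)
  then show "gdist \<Gamma> x z \<le> gdist \<Gamma> x y + gdist \<Gamma> y z" by simp
qed

abbreviation gtopology :: "('v, 'e) mgraph \<Rightarrow> ('v, 'e) gpoint topology" where
  "gtopology \<Gamma> \<equiv> Metric_space.mtopology (points \<Gamma>) (gdist \<Gamma>)"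


section \<open>Divisors and piecewise-linear functions\<close>

definition supp :: "('p \<Rightarrow> int) \<Rightarrow> 'p set" where
  "supp D = {p. D p \<noteq> 0}"

definition divisors :: "('v, 'e) mgraph \<Rightarrow> (('v, 'e) gpoint \<Rightarrow> int) set" where
  "divisors \<Gamma> = {D. finite (supp D) \<and> supp D \<subseteq> points \<Gamma>}"

definition effective :: "('p \<Rightarrow> int) \<Rightarrow> bool" where
  "effective D \<longleftrightarrow> (\<forall>p. 0 \<le> D p)"

definition degree :: "('p \<Rightarrow> int) \<Rightarrow> int" where
  "degree D = (\<Sum>p\<in>supp D. D p)"

definition piecewise_linear_on :: "real \<Rightarrow> (real \<Rightarrow> real) \<Rightarrow> bool" where
  "piecewise_linear_on L f \<longleftrightarrow>
     (\<exists>B. finite B \<and> (\<forall>a b. 0 \<le> a \<and> a < b \<and> b \<le> L \<and> {a<..<b} \<inter> B = {} \<longrightarrow>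
        (\<exists>(m::int) c. \<forall>t\<in>{a<..<b}. f t = of_int m * t + c)))"

text \<open>Functions on the metric graph are extensional, so that equality is equality on its points.\<close>

definition PL :: "('v, 'e) mgraph \<Rightarrow> (('v, 'e) gpoint \<Rightarrow> real) set" where
  "PL \<Gamma> = {\<phi> \<in> extensional (points \<Gamma>).
     continuous_map (gtopology \<Gamma>) euclideanreal \<phi> \<and>
     (\<forall>e\<in>edges \<Gamma>. piecewise_linear_on (len \<Gamma> e) (\<lambda>t. \<phi> (edge_pt \<Gamma> e t)))}"

text \<open>
  A tangent direction at \<open>p\<close> is a triple \<open>(e, t, \<sigma>)\<close>: \<open>p\<close> sits at parameter \<open>t\<close> on the edge \<open>e\<close>, and one
  leaves \<open>p\<close> along \<open>e\<close> with increasing (\<open>\<sigma> = 1\<close>) or decreasing (\<open>\<sigma> = -1\<close>) parameter. A loop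
  contributes two tangent directions at its base vertex.
\<close>

definition tangents :: "('v, 'e) mgraph \<Rightarrow> ('v, 'e) gpoint \<Rightarrow> ('e \<times> real \<times> real) set" where
  "tangents \<Gamma> p = {(e, t, \<sigma>). e \<in> edges \<Gamma> \<and> t \<in> {0..len \<Gamma> e} \<and> edge_pt \<Gamma> e t = p \<and>
     (\<sigma> = 1 \<and> t < len \<Gamma> e \<or> \<sigma> = -1 \<and> 0 < t)}"

definition outgoing_slope ::
  "('v, 'e) mgraph \<Rightarrow> (('v, 'e) gpoint \<Rightarrow> real) \<Rightarrow> 'e \<times> real \<times> real \<Rightarrow> int" where
  "outgoing_slope \<Gamma> \<phi> = (\<lambda>(e, t, \<sigma>). THE m.
     \<forall>\<^sub>F h in at_right 0. \<phi> (edge_pt \<Gamma> e (t + \<sigma> * h)) = \<phi> (edge_pt \<Gamma> e t) + of_int m * h)"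

text \<open>
  The sum of the incoming slopes, so that \<open>pl_div \<Gamma> \<phi> p\<close> is nonnegative at a local maximum \<open>p\<close> of \<open>\<phi>\<close>.
\<close>

definition pl_div ::
  "('v, 'e) mgraph \<Rightarrow> (('v, 'e) gpoint \<Rightarrow> real) \<Rightarrow> ('v, 'e) gpoint \<Rightarrow> int" where
  "pl_div \<Gamma> \<phi> p = - (\<Sum>d\<in>tangents \<Gamma> p. outgoing_slope \<Gamma> \<phi> d)"

definition Rmod :: "('v, 'e) mgraph \<Rightarrow> (('v, 'e) gpoint \<Rightarrow> int) \<Rightarrow> (('v, 'e) gpoint \<Rightarrow> real) set" where
  "Rmod \<Gamma> D = {\<phi> \<in> PL \<Gamma>. effective (\<lambda>p. D p + pl_div \<Gamma> \<phi> p)}"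

definition linear_system ::
  "('v, 'e) mgraph \<Rightarrow> (('v, 'e) gpoint \<Rightarrow> int) \<Rightarrow> (('v, 'e) gpoint \<Rightarrow> real) set
    \<Rightarrow> (('v, 'e) gpoint \<Rightarrow> int) set" where
  "linear_system \<Gamma> D \<Sigma> = (\<lambda>\<phi> p. D p + pl_div \<Gamma> \<phi> p) ` \<Sigma>"


section \<open>Tropical linear series\<close>

text \<open>The zero element \<open>\<infinity>\<close> of a tropical module is not represented.\<close>

definition tropical_submodule ::
  "('v, 'e) mgraph \<Rightarrow> (('v, 'e) gpoint \<Rightarrow> int) \<Rightarrow> (('v, 'e) gpoint \<Rightarrow> real) set \<Rightarrow> bool" where
  "tropical_submodule \<Gamma> D \<Sigma> \<longleftrightarrow> \<Sigma> \<subseteq> Rmod \<Gamma> D \<and>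
     (\<forall>\<phi>\<in>\<Sigma>. \<forall>\<psi>\<in>\<Sigma>. (\<lambda>p\<in>points \<Gamma>. min (\<phi> p) (\<psi> p)) \<in> \<Sigma>) \<and>
     (\<forall>\<phi>\<in>\<Sigma>. \<forall>c. (\<lambda>p\<in>points \<Gamma>. \<phi> p + c) \<in> \<Sigma>)"

text \<open>
  Ranging over the nonempty subsets \<open>T'\<close> of \<open>T\<close> amounts to allowing coefficients \<open>\<infinity>\<close>, not all of
  them infinite.
\<close>

definition tropical_combinations ::
  "('v, 'e) mgraph \<Rightarrow> (('v, 'e) gpoint \<Rightarrow> real) set \<Rightarrow> (('v, 'e) gpoint \<Rightarrow> real) set" where
  "tropical_combinations \<Gamma> T =
     {(\<lambda>p\<in>points \<Gamma>. MIN \<phi>\<in>T'. \<phi> p + a \<phi>) | T' a. T' \<subseteq> T \<and> T' \<noteq> {}}"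

definition tropically_fin_gen ::
  "('v, 'e) mgraph \<Rightarrow> (('v, 'e) gpoint \<Rightarrow> real) set \<Rightarrow> bool" where
  "tropically_fin_gen \<Gamma> \<Sigma> \<longleftrightarrow> (\<exists>T. finite T \<and> T \<subseteq> \<Sigma> \<and> \<Sigma> = tropical_combinations \<Gamma> T)"

definition tropically_dependent ::
  "('v, 'e) mgraph \<Rightarrow> (('v, 'e) gpoint \<Rightarrow> real) set \<Rightarrow> bool" where
  "tropically_dependent \<Gamma> T \<longleftrightarrow>
     (\<exists>a. \<forall>p\<in>points \<Gamma>. 2 \<le> card {\<phi> \<in> T. \<phi> p + a \<phi> = (MIN \<psi>\<in>T. \<psi> p + a \<psi>)})"

definition r_ind :: "('v, 'e) mgraph \<Rightarrow> (('v, 'e) gpoint \<Rightarrow> real) set \<Rightarrow> enat" where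
  "r_ind \<Gamma> \<Sigma> = (SUP T\<in>{T. finite T \<and> T \<subseteq> \<Sigma> \<and> \<not> tropically_dependent \<Gamma> T}. enat (card T))"

text \<open>
  Negative \<open>r\<close> satisfy the condition vacuously and, for \<open>\<Sigma> \<subseteq> R(D)\<close>, any nonnegative \<open>r\<close>
  greater than the degree of \<open>D\<close> violates it, so the greatest such integer exists.
\<close>

definition r_BN ::
  "('v, 'e) mgraph \<Rightarrow> (('v, 'e) gpoint \<Rightarrow> int) \<Rightarrow> (('v, 'e) gpoint \<Rightarrow> real) set \<Rightarrow> int" where
  "r_BN \<Gamma> D \<Sigma> = (GREATEST r. \<forall>D'\<in>divisors \<Gamma>. effective D' \<and> degree D' = r \<longrightarrow>
     (\<exists>\<phi>\<in>\<Sigma>. effective (\<lambda>p. D p - D' p + pl_div \<Gamma> \<phi> p)))"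

definition tropical_linear_series ::
  "('v, 'e) mgraph \<Rightarrow> (('v, 'e) gpoint \<Rightarrow> int) \<Rightarrow> nat \<Rightarrow> (('v, 'e) gpoint \<Rightarrow> real) set \<Rightarrow> bool" where
  "tropical_linear_series \<Gamma> D r \<Sigma> \<longleftrightarrow>
     tropical_submodule \<Gamma> D \<Sigma> \<and> tropically_fin_gen \<Gamma> \<Sigma> \<and>
     r_BN \<Gamma> D \<Sigma> = int r \<and> r_ind \<Gamma> \<Sigma> = enat (r + 1)"


section \<open>Minimizers\<close>

definition supp_complement_components ::
  "('v, 'e) mgraph \<Rightarrow> (('v, 'e) gpoint \<Rightarrow> int) \<Rightarrow> ('v, 'e) gpoint set set" where
  "supp_complement_components \<Gamma> D =
     connected_components_of (subtopology (gtopology \<Gamma>) (points \<Gamma> - supp D))"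

definition minimizers ::
  "('v, 'e) mgraph \<Rightarrow> (('v, 'e) gpoint \<Rightarrow> real) \<Rightarrow> ('v, 'e) gpoint set" where
  "minimizers \<Gamma> \<phi> = {p \<in> points \<Gamma>. \<forall>q\<in>points \<Gamma>. \<phi> p \<le> \<phi> q}"

definition Fset ::
  "('v, 'e) mgraph \<Rightarrow> (('v, 'e) gpoint \<Rightarrow> int) \<Rightarrow> (('v, 'e) gpoint \<Rightarrow> real) \<Rightarrow> ('v, 'e) gpoint set set" where
  "Fset \<Gamma> D \<phi> = {S \<in> supp_complement_components \<Gamma> D. \<not> S \<subseteq> minimizers \<Gamma> \<phi>}"

definition big_minimizers ::
  "('v, 'e) mgraph \<Rightarrow> (('v, 'e) gpoint \<Rightarrow> int) \<Rightarrow> (('v, 'e) gpoint \<Rightarrow> real) set \<Rightarrow> bool" where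
  "big_minimizers \<Gamma> D \<Sigma> \<longleftrightarrow>
     (\<forall>\<phi>\<in>\<Sigma>. \<exists>S\<in>supp_complement_components \<Gamma> D. S \<subseteq> minimizers \<Gamma> \<phi>)"


section \<open>Matroids\<close>

definition matroid :: "'a set \<Rightarrow> 'a set set \<Rightarrow> bool" where
  "matroid E Ind \<longleftrightarrow> finite E \<and> Ind \<subseteq> Pow E \<and> {} \<in> Ind \<and>
     (\<forall>X\<in>Ind. \<forall>Y\<subseteq>X. Y \<in> Ind) \<and>
     (\<forall>X\<in>Ind. \<forall>Y\<in>Ind. card X < card Y \<longrightarrow> (\<exists>y\<in>Y - X. insert y X \<in> Ind))"

definition matroid_rank :: "'a set set \<Rightarrow> 'a set \<Rightarrow> nat" where
  "matroid_rank Ind X = Max (card ` {Y \<in> Ind. Y \<subseteq> X})"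

definition matroid_closure :: "'a set \<Rightarrow> 'a set set \<Rightarrow> 'a set \<Rightarrow> 'a set" where
  "matroid_closure E Ind X = {x \<in> E. matroid_rank Ind (insert x X) = matroid_rank Ind X}"

definition flats :: "'a set \<Rightarrow> 'a set set \<Rightarrow> 'a set set" where
  "flats E Ind = {X. X \<subseteq> E \<and> matroid_closure E Ind X = X}"

definition loopless :: "'a set \<Rightarrow> 'a set set \<Rightarrow> bool" where
  "loopless E Ind \<longleftrightarrow> (\<forall>x\<in>E. {x} \<in> Ind)"

end

theory Submission
  imports Defs
begin

text \<open>
  A function in \<open>R(D)\<close> is superharmonic off the support of \<open>D\<close>, so each component of the complement
  lies inside its set of minimizers or is disjoint from it. Hence \<open>\<phi> \<mapsto> F\<^sub>\<phi>\<close> turns minima (of functions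
  normalized to have minimum \<open>0\<close>) into intersections. If the sets \<open>F\<^sub>\<phi>\<close> of some functions form a
  chain, the functions are tropically independent, so chains have at most \<open>r + 1\<close> members. The
  Baker--Norine condition, applied to one point in each of \<open>r\<close> components, puts any \<open>r\<close> components
  into a common \<open>F\<^sub>\<phi>\<close>. Thus adding one new element at a time always produces a chain of closed sets
  of the maximal length, which therefore admits no refinement; this is the exchange property of the
  closure operator.
\<close>

section \<open>Matroids from intersection-closed families\<close>

text \<open>These are properties of the proper flats of a matroid of rank \<open>r + 1\<close>. A
  maximal chain of proper flats has one member in each rank from \<open>0\<close> to
  \<open>r\<close>, hence the bound \<open>r + 1\<close>; \<open>cover\<close> says that
  \<open>r\<close> elements never span.\<close>

locale graded_intersection_family =
  fixes E :: "'a set" and \<F> :: "'a set set" and r :: nat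
  assumes finite_ground: "finite E"
    and proper: "F \<in> \<F> \<Longrightarrow> F \<subset> E"
    and inter: "\<lbrakk>F \<in> \<F>; G \<in> \<F>\<rbrakk> \<Longrightarrow> F \<inter> G \<in> \<F>"
    and cover: "\<lbrakk>A \<subseteq> E; card A \<le> r\<rbrakk> \<Longrightarrow> \<exists>F\<in>\<F>. A \<subseteq> F"
    and chain_bound: "\<lbrakk>finite \<C>; \<C> \<subseteq> \<F>; \<And>X Y. \<lbrakk>X \<in> \<C>; Y \<in> \<C>\<rbrakk> \<Longrightarrow> X \<subseteq> Y \<or> Y \<subseteq> X\<rbrakk>
      \<Longrightarrow> card \<C> \<le> r + 1"
begin

text \<open>\<open>E\<close> is adjoined so that the intersected collection is nonempty for every
  \<open>X\<close> inside \<open>E\<close>. For any other \<open>X\<close> the collection is empty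
  and \<open>cl X\<close> is \<open>UNIV\<close>.\<close>

definition cl :: "'a set \<Rightarrow> 'a set" where
  "cl X = \<Inter> {F \<in> \<F> \<union> {E}. X \<subseteq> F}"

lemma cl_subset: "X \<subseteq> E \<Longrightarrow> cl X \<subseteq> E"
  by (auto simp: cl_def)

lemma cl_extensive: "X \<subseteq> cl X"
  by (auto simp: cl_def)

lemma cl_mono: "X \<subseteq> Y \<Longrightarrow> cl X \<subseteq> cl Y"
  by (auto simp: cl_def)

lemma cl_idem: "cl (cl X) = cl X"
proof -
  have "cl X \<subseteq> F \<longleftrightarrow> X \<subseteq> F" if "F \<in> \<F> \<union> {E}" for F
    unfolding cl_def using that by blast
  then have "{F \<in> \<F> \<union> {E}. cl X \<subseteq> F} = {F \<in> \<F> \<union> {E}. X \<subseteq> F}" by blast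
  then show ?thesis by (simp add: cl_def)
qed

lemma cl_least: "X \<subseteq> cl Y \<Longrightarrow> cl X \<subseteq> cl Y"
  using cl_mono[of X "cl Y"] by (simp add: cl_idem)

text \<open>Used to change the generators of a closed set while further elements are being
  added.\<close>

lemma cl_Un_cong: "cl X = cl Y \<Longrightarrow> cl (Z \<union> X) = cl (Z \<union> Y)"
proof (rule equalityI; rule cl_least)
  assume eq: "cl X = cl Y"
  show "Z \<union> X \<subseteq> cl (Z \<union> Y)"
    using cl_extensive[of "Z \<union> Y"] cl_extensive[of X] cl_mono[of Y "Z \<union> Y"] eq by blast
  show "Z \<union> Y \<subseteq> cl (Z \<union> X)"
    using cl_extensive[of "Z \<union> X"] cl_extensive[of Y] cl_mono[of X "Z \<union> X"] eq by blast
qed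

text \<open>The family is only assumed closed under binary intersections; the collection defining
  \<open>cl X\<close> is finite because \<open>E\<close> is, so induction over it suffices. A factor
  \<open>E\<close> is absorbed by any other member.\<close>

lemma cl_closed:
  assumes "X \<subseteq> E"
  shows "cl X \<in> \<F> \<union> {E}"
proof -
  have fin: "finite {F \<in> \<F> \<union> {E}. X \<subseteq> F}"
    by (rule finite_subset[of _ "Pow E"]) (use proper finite_ground in auto)
  have "\<Inter>\<G> \<in> \<F> \<union> {E}" if "finite \<G>" "\<G> \<noteq> {}" "\<G> \<subseteq> \<F> \<union> {E}" for \<G>
    using that
  proof (induction \<G> rule: finite_ne_induct)
    case (insert F \<G>)
    then have "F \<inter> \<Inter>\<G> \<in> \<F> \<union> {E}"
      using inter[of F "\<Inter>\<G>"] proper[of F] proper[of "\<Inter>\<G>"] by (auto simp: Int_absorb1 Int_absorb2)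
    then show ?case by simp
  qed auto
  from this[OF fin] assms show ?thesis by (auto simp: cl_def)
qed

lemma closed_iff: "X \<subseteq> E \<and> cl X = X \<longleftrightarrow> X \<in> \<F> \<union> {E}"
proof
  assume "X \<subseteq> E \<and> cl X = X"
  then show "X \<in> \<F> \<union> {E}" using cl_closed[of X] by simp
next
  assume X: "X \<in> \<F> \<union> {E}"
  then have "cl X \<subseteq> X" by (auto simp: cl_def)
  then show "X \<subseteq> E \<and> cl X = X" using X proper cl_extensive[of X] by blast
qed

lemma cl_small:
  assumes "X \<subseteq> E" "card X \<le> r"
  shows "cl X \<subset> E"
proof -
  obtain F where "F \<in> \<F>" "X \<subseteq> F" using cover[OF assms] by blast
  then have "cl X \<subseteq> F" by (auto simp: cl_def)
  then show ?thesis using proper[OF \<open>F \<in> \<F>\<close>] by blast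
qed

text \<open>Lists are read from the end, so that \<open>x # xs\<close> adds the element \<open>x\<close> last.\<close>

fun free_list :: "'a list \<Rightarrow> bool" where
  "free_list [] \<longleftrightarrow> True"
| "free_list (x # xs) \<longleftrightarrow> x \<in> E \<and> x \<notin> cl (set xs) \<and> free_list xs"

lemma free_list_subset: "free_list xs \<Longrightarrow> set xs \<subseteq> E"
  by (induction xs) auto

text \<open>The chain consists of the closures of the proper tails of \<open>xs\<close>. Each misses
  the element of \<open>E\<close> added next, so it is not \<open>E\<close> and belongs to
  \<open>\<F>\<close>. The closure of the whole list may be \<open>E\<close> and is left
  out.\<close>

lemma free_list_chain:
  assumes "free_list xs"
  shows "\<exists>\<C>. finite \<C> \<and> \<C> \<subseteq> \<F> \<and> (\<forall>X\<in>\<C>. \<forall>Y\<in>\<C>. X \<subseteq> Y \<or> Y \<subseteq> X) \<and>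
    (\<forall>X\<in>\<C>. X \<subset> cl (set xs)) \<and> card \<C> = length xs"
  using assms
proof (induction xs)
  case Nil
  then show ?case by (intro exI[of _ "{}"]) auto
next
  case (Cons x xs)
  then obtain \<C> where \<C>: "finite \<C>" "\<C> \<subseteq> \<F>" "\<forall>X\<in>\<C>. \<forall>Y\<in>\<C>. X \<subseteq> Y \<or> Y \<subseteq> X"
    "\<forall>X\<in>\<C>. X \<subset> cl (set xs)" "card \<C> = length xs" by auto
  have "cl (set xs) \<in> \<F>"
    using cl_closed[of "set xs"] free_list_subset[of xs] Cons.prems by auto
  moreover have "cl (set xs) \<subset> cl (set (x # xs))"
    using Cons.prems cl_mono[of "set xs" "set (x # xs)"] cl_extensive[of "set (x # xs)"] by auto
  moreover have "cl (set xs) \<notin> \<C>" using \<C>(4) by blast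
  moreover have "\<forall>X\<in>\<C>. X \<subset> cl (set (x # xs))"
    using \<C>(4) cl_mono[of "set xs" "set (x # xs)"] by auto
  moreover have "\<forall>X\<in>insert (cl (set xs)) \<C>. \<forall>Y\<in>insert (cl (set xs)) \<C>. X \<subseteq> Y \<or> Y \<subseteq> X"
    using \<C>(3,4) by blast
  ultimately show ?case using \<C>(1,2,5)
    by (intro exI[of _ "insert (cl (set xs)) \<C>"]) simp
qed

lemma free_list_length: "free_list xs \<Longrightarrow> length xs \<le> r + 1"
  using free_list_chain[of xs] chain_bound by metis

text \<open>A free list with at most \<open>r\<close> entries does not span \<open>E\<close>, by
  \<open>cover\<close>, so another element can be put in front.\<close>

lemma free_list_extend:
  assumes "free_list xs" "length xs \<le> r + 1"
  shows "\<exists>zs. free_list (zs @ xs) \<and> length (zs @ xs) = r + 1"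
  using assms
proof (induction "r + 1 - length xs" arbitrary: xs)
  case 0
  then show ?case by (intro exI[of _ "[]"]) auto
next
  case (Suc k)
  then have "cl (set xs) \<subset> E"
    using card_length[of xs] by (intro cl_small free_list_subset) auto
  then obtain x where "x \<in> E" "x \<notin> cl (set xs)" by blast
  moreover have "k = r + 1 - length (x # xs)" "length (x # xs) \<le> r + 1"
    using Suc.hyps(2) by simp_all
  ultimately obtain zs where "free_list (zs @ x # xs)" "length (zs @ x # xs) = r + 1"
    using Suc.hyps(1)[of "x # xs"] Suc.prems(1) free_list.simps(2) by blast
  then show ?case by (intro exI[of _ "zs @ [x]"]) auto
qed

text \<open>Take a longest free list inside \<open>X\<close>, which exists by the chain bound. An
  element of \<open>X\<close> outside its closure could be put in front.\<close>

lemma free_list_spanning: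
  assumes "X \<subseteq> E"
  shows "\<exists>xs. free_list xs \<and> set xs \<subseteq> X \<and> cl (set xs) = cl X"
proof -
  have "\<exists>xs. (free_list xs \<and> set xs \<subseteq> X) \<and>
      (\<forall>ys. free_list ys \<and> set ys \<subseteq> X \<longrightarrow> length ys \<le> length xs)"
    by (rule ex_has_greatest_nat[of _ "[]" _ "r + 2"]) (use free_list_length in fastforce)+
  then obtain xs where xs: "free_list xs" "set xs \<subseteq> X"
    and max: "\<And>ys. \<lbrakk>free_list ys; set ys \<subseteq> X\<rbrakk> \<Longrightarrow> length ys \<le> length xs" by blast
  have "X \<subseteq> cl (set xs)"
  proof
    fix x assume "x \<in> X"
    then show "x \<in> cl (set xs)" using max[of "x # xs"] xs assms by (auto simp: subset_iff)
  qed
  then have "cl (set xs) = cl X" using xs(2) by (intro equalityI cl_least[of X] cl_mono)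
  then show ?thesis using xs by blast
qed

text \<open>Whether the entries of \<open>zs\<close> are free depends on the tail only through its
  closure, so \<open>zs\<close> can be moved onto another free list with the same closure.\<close>

lemma free_list_cong:
  assumes "cl (set us) = cl (set vs)" "free_list vs" "free_list (zs @ us)"
  shows "free_list (zs @ vs)"
  using assms(3)
proof (induction zs)
  case (Cons z zs)
  then show ?case using cl_Un_cong[OF assms(1), of "set zs"] by simp
qed (use assms(2) in simp)

text \<open>
  If exchange failed, then \<open>y\<close> could be inserted just before \<open>x\<close> into a maximal free list,
  making it longer than any chain permits.
\<close>

lemma exchange:
  assumes "X \<subseteq> E" "x \<in> E" "y \<in> cl (insert x X)" "y \<notin> cl X"
  shows "x \<in> cl (insert y X)"
proof (rule ccontr)
  assume x: "x \<notin> cl (insert y X)"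
  obtain xs where xs: "free_list xs" "set xs \<subseteq> X" "cl (set xs) = cl X"
    using free_list_spanning[OF assms(1)] by blast
  have ins: "cl (insert z (set xs)) = cl (insert z X)" for z
    using cl_Un_cong[OF xs(3), of "{z}"] by simp
  have y: "y \<in> E" using assms cl_subset[of "insert x X"] by auto
  have "cl X \<subseteq> cl (insert y X)" by (intro cl_mono) auto
  then have fx: "free_list (x # xs)" using xs(1,3) x assms(2) by auto
  obtain zs where zs: "free_list (zs @ x # xs)" "length (zs @ x # xs) = r + 1"
    using free_list_extend[OF fx free_list_length[OF fx]] by blast
  have fxy: "free_list (x # y # xs)" using xs(1,3) x y assms(2,4) ins by simp
  \<comment> \<open>Because \<open>y\<close> already lies in \<open>cl (insert x X)\<close>,
    inserting it leaves the closure of \<open>x # xs\<close> unchanged, and \<open>zs\<close> stays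
    free on top of the longer list.\<close>
  have "cl (insert x (insert y X)) = cl (insert x X)"
    using assms(3) cl_extensive[of "insert x X"] by (intro equalityI cl_least cl_mono) auto
  then have "cl (set (x # xs)) = cl (set (x # y # xs))"
    using cl_Un_cong[OF xs(3), of "{x}"] cl_Un_cong[OF xs(3), of "{x, y}"] by simp
  from free_list_cong[OF this fxy zs(1)] have "length (zs @ x # y # xs) \<le> r + 1"
    by (rule free_list_length)
  then show False using zs(2) by simp
qed

section \<open>Independent sets of the closure operator\<close>

definition indep :: "'a set set" where
  "indep = {X. X \<subseteq> E \<and> (\<forall>x\<in>X. x \<notin> cl (X - {x}))}"

lemma indep_ground: "X \<in> indep \<Longrightarrow> X \<subseteq> E"
  by (simp add: indep_def)

lemma empty_indep: "{} \<in> indep"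
  by (simp add: indep_def)

lemma indep_subset:
  assumes "X \<in> indep" "Y \<subseteq> X"
  shows "Y \<in> indep"
proof -
  have "y \<notin> cl (Y - {y})" if "y \<in> Y" for y
    using that assms cl_mono[of "Y - {y}" "X - {y}"] by (auto simp: indep_def)
  then show ?thesis using assms by (auto simp: indep_def)
qed

text \<open>If an old element \<open>x\<close> came to depend on \<open>y\<close> and the rest of
  \<open>X\<close>, exchange would put \<open>y\<close> into \<open>cl X\<close>.\<close>

lemma indep_insert:
  assumes X: "X \<in> indep" and y: "y \<in> E" "y \<notin> cl X"
  shows "insert y X \<in> indep"
proof -
  have "x \<notin> cl (insert y X - {x})" if x: "x \<in> insert y X" for x
  proof
    assume cl: "x \<in> cl (insert y X - {x})"
    have yX: "y \<notin> X" using y(2) cl_extensive by blast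
    show False
    proof (cases "x = y")
      case True
      then show False using cl y(2) yX by simp
    next
      case False
      then have "x \<in> X" using x by simp
      moreover from this have "x \<notin> cl (X - {x})" using X by (simp add: indep_def)
      moreover have "insert y X - {x} = insert y (X - {x})" using False by auto
      ultimately have "y \<in> cl (insert x (X - {x}))"
        using exchange[of "X - {x}" y x] cl X y(1) by (auto simp: indep_def)
      then show False using y(2) \<open>x \<in> X\<close> by (simp add: insert_absorb)
    qed
  qed
  then show ?thesis using X y(1) by (auto simp: indep_def)
qed

lemma finite_indep: "X \<in> indep \<Longrightarrow> finite X"
  using finite_subset[OF indep_ground finite_ground] .

text \<open>Steinitz exchange: an element of \<open>Y - X\<close> is traded for one of
  \<open>X\<close>, which keeps independence and cardinality and shrinks
  \<open>Y - X\<close>.\<close>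

lemma indep_card_le:
  assumes "Y \<in> indep" "Y \<subseteq> cl X" "X \<subseteq> E"
  shows "card Y \<le> card X"
  using assms(1,2)
proof (induction "card (Y - X)" arbitrary: Y rule: less_induct)
  case less
  have fin: "finite X" "finite Y"
    using finite_subset[OF assms(3) finite_ground] finite_indep[OF less.prems(1)] by auto
  show ?case
  proof (cases "Y \<subseteq> X")
    case True
    then show ?thesis using fin card_mono by blast
  next
    case False
    then obtain y where y: "y \<in> Y" "y \<notin> X" by blast
    have "y \<notin> cl (Y - {y})" using less.prems(1) y(1) by (simp add: indep_def)
    \<comment> \<open>Otherwise \<open>cl X\<close>, which contains \<open>y\<close>, would lie in
      \<open>cl (Y - {y})\<close>.\<close>
    then have "\<not> X \<subseteq> cl (Y - {y})" using cl_least[of X "Y - {y}"] y(1) less.prems(2) by auto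
    then obtain x where x: "x \<in> X" "x \<notin> cl (Y - {y})" by auto
    have xY: "x \<notin> Y" using x cl_extensive[of "Y - {y}"] y by blast
    have "Y - {y} \<in> indep" using indep_subset[OF less.prems(1), of "Y - {y}"] by blast
    then have "insert x (Y - {y}) \<in> indep" using x assms(3) by (intro indep_insert) auto
    moreover have "insert x (Y - {y}) \<subseteq> cl X" using x(1) cl_extensive less.prems(2) by blast
    moreover have "card (insert x (Y - {y}) - X) < card (Y - X)"
      using x y fin by (intro psubset_card_mono) auto
    ultimately have "card (insert x (Y - {y})) \<le> card X" by (intro less.hyps)
    then show ?thesis using xY y(1) fin by (simp add: card.insert_remove card_Suc_Diff1)
  qed
qed

section \<open>Matroid axioms, rank and flats\<close>

lemma matroid_indep: "matroid E indep"
  unfolding matroid_def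
proof (intro conjI ballI impI allI)
  fix X Y assume X: "X \<in> indep" and Y: "Y \<in> indep" and "card X < card Y"
  then have "\<not> Y \<subseteq> cl X" using indep_card_le[OF Y _ indep_ground[OF X]] by linarith
  then obtain y where "y \<in> Y" "y \<notin> cl X" by auto
  moreover from this have "y \<notin> X" using cl_extensive by blast
  ultimately show "\<exists>y\<in>Y - X. insert y X \<in> indep"
    using indep_insert[OF X, of y] indep_ground[OF Y] by blast
next
  show "Y \<in> indep" if "X \<in> indep" "Y \<subseteq> X" for X Y using indep_subset that by blast
qed (use finite_ground indep_ground empty_indep in auto)

text \<open>Every independent subset of \<open>X\<close> lies in \<open>cl B\<close> and so is no
  larger than \<open>B\<close>.\<close>

lemma matroid_rank_eqI:
  assumes "B \<in> indep" "B \<subseteq> X" "X \<subseteq> cl B"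
  shows "matroid_rank indep X = card B"
  unfolding matroid_rank_def
proof (rule Max_eqI)
  have "{Y \<in> indep. Y \<subseteq> X} \<subseteq> Pow E" using indep_ground by blast
  then show "finite (card ` {Y \<in> indep. Y \<subseteq> X})"
    using finite_subset[OF _ finite_Pow_iff[THEN iffD2, OF finite_ground]] by blast
  show "n \<le> card B" if "n \<in> card ` {Y \<in> indep. Y \<subseteq> X}" for n
    using that assms indep_card_le[OF _ _ indep_ground[OF assms(1)]] by blast
qed (use assms in auto)

lemma basis_exists:
  assumes "X \<subseteq> E"
  shows "\<exists>B\<in>indep. B \<subseteq> X \<and> X \<subseteq> cl B"
proof -
  have "\<exists>B. (B \<in> indep \<and> B \<subseteq> X) \<and> (\<forall>Y. Y \<in> indep \<and> Y \<subseteq> X \<longrightarrow> card Y \<le> card B)"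
  proof (rule ex_has_greatest_nat[of _ "{}" _ "Suc (card E)"])
    show "\<forall>Y. Y \<in> indep \<and> Y \<subseteq> X \<longrightarrow> card Y < Suc (card E)"
      using card_mono[OF finite_ground indep_ground] by (auto simp: less_Suc_eq_le)
  qed (simp add: empty_indep)
  then obtain B where B: "B \<in> indep" "B \<subseteq> X"
    and max: "\<And>Y. \<lbrakk>Y \<in> indep; Y \<subseteq> X\<rbrakk> \<Longrightarrow> card Y \<le> card B" by blast
  have "X \<subseteq> cl B"
  proof
    fix x assume x: "x \<in> X"
    show "x \<in> cl B"
    proof (rule ccontr)
      assume "x \<notin> cl B"
      moreover from this have "x \<notin> B" using cl_extensive by blast
      ultimately show False
        using max[of "insert x B"] indep_insert[OF B(1), of x] B(2) x assms finite_indep[OF B(1)]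
        by (auto simp: subset_iff)
    qed
  qed
  then show ?thesis using B by blast
qed

text \<open>A basis \<open>B\<close> of \<open>X\<close> is still a basis of
  \<open>insert x X\<close> when \<open>x\<close> is in \<open>cl X\<close>; otherwise
  \<open>insert x B\<close> is one and the rank grows.\<close>

lemma matroid_closure_eq:
  assumes "X \<subseteq> E"
  shows "matroid_closure E indep X = cl X"
proof -
  obtain B where B: "B \<in> indep" "B \<subseteq> X" "X \<subseteq> cl B" using basis_exists[OF assms] by blast
  have clB: "cl X = cl B" using B cl_mono cl_least by blast
  have "matroid_rank indep (insert x X) = matroid_rank indep X \<longleftrightarrow> x \<in> cl X" if x: "x \<in> E" for x
  proof (cases "x \<in> cl X")
    case True
    then have "matroid_rank indep (insert x X) = card B"
      using B clB by (intro matroid_rank_eqI) auto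
    then show ?thesis using True matroid_rank_eqI[OF B] by simp
  next
    case False
    then have "x \<notin> B" using clB cl_extensive by blast
    have "matroid_rank indep (insert x X) = card (insert x B)"
      using False B x clB cl_mono[of B "insert x B"] cl_extensive[of "insert x B"]
      by (intro matroid_rank_eqI indep_insert) auto
    then show ?thesis
      using False matroid_rank_eqI[OF B] \<open>x \<notin> B\<close> finite_indep[OF B(1)] by simp
  qed
  then show ?thesis using cl_subset[OF assms] by (auto simp: matroid_closure_def)
qed

lemma flats_indep: "flats E indep = \<F> \<union> {E}"
proof -
  have "flats E indep = {X. X \<subseteq> E \<and> cl X = X}"
    using matroid_closure_eq by (auto simp: flats_def)
  then show ?thesis by (simp only: closed_iff Collect_mem_eq)
qed

text \<open>Any enumeration of an independent set without repetition is a free list, so the chain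
  bound applies.\<close>

lemma indep_card:
  assumes "X \<in> indep"
  shows "card X \<le> r + 1"
proof -
  obtain xs where xs: "set xs = X" "distinct xs"
    using finite_distinct_list finite_indep assms by blast
  then have "free_list xs" using assms
  proof (induction xs arbitrary: X)
    case (Cons x xs)
    then have "free_list xs" using indep_subset[of X "set xs"] by auto
    moreover have "X - {x} = set xs" using Cons.prems by auto
    ultimately show ?case using Cons.prems by (auto simp: indep_def)
  qed auto
  then show ?thesis using free_list_length xs distinct_card by metis
qed

text \<open>A basis of \<open>E\<close> has at most \<open>r + 1\<close> elements by the chain bound
  and more than \<open>r\<close> by \<open>cover\<close>.\<close>

lemma rank_indep: "matroid_rank indep E = r + 1"
proof -
  obtain B where B: "B \<in> indep" "B \<subseteq> E" "E \<subseteq> cl B" using basis_exists[of E] by blast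
  then have "\<not> card B \<le> r" using cl_small[of B] by blast
  then show ?thesis using indep_card[OF B(1)] matroid_rank_eqI[OF B] by simp
qed

text \<open>The loops are the elements of \<open>cl {}\<close>. As \<open>E\<close> is nonempty,
  \<open>{}\<close> can be closed only as a member of \<open>\<F>\<close>.\<close>

lemma loopless_indep: "loopless E indep \<longleftrightarrow> {} \<in> \<F>"
proof -
  have ne: "{} \<noteq> E" using cover[of "{}"] proper by auto
  have "loopless E indep \<longleftrightarrow> (\<forall>x\<in>E. x \<notin> cl {})" by (auto simp: loopless_def indep_def)
  also have "\<dots> \<longleftrightarrow> cl {} = {}" using cl_subset[of "{}"] by auto
  also have "\<dots> \<longleftrightarrow> {} \<in> \<F>" using closed_iff[of "{}"] ne by auto
  finally show ?thesis .
qed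

end


section \<open>Topology of metric graphs\<close>

text \<open>The segment between two parameters is itself a path, so the parametrization is
  1-Lipschitz.\<close>

lemma continuous_map_edge_pt:
  assumes "metric_graph \<Gamma>" "e \<in> edges \<Gamma>"
  shows "continuous_map (top_of_set {0..len \<Gamma> e}) (gtopology \<Gamma>) (edge_pt \<Gamma> e)"
proof -
  interpret Metric_space "points \<Gamma>" "gdist \<Gamma>" by (rule Metric_space_gdist[OF assms(1)])
  have lip: "gdist \<Gamma> (edge_pt \<Gamma> e s) (edge_pt \<Gamma> e t) \<le> \<bar>t - s\<bar>"
    if "s \<in> {0..len \<Gamma> e}" "t \<in> {0..len \<Gamma> e}" for s t
    using path_length_segment[OF assms that] edge_pt_in_points[OF assms] path_length_nonneg
    by (auto simp: gdist_def intro!: cInf_lower bdd_belowI[of _ 0])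
  show ?thesis unfolding continuous_map_to_metric
  proof (intro ballI allI impI)
    fix s \<epsilon> :: real
    assume s: "s \<in> topspace (top_of_set {0..len \<Gamma> e})" and \<epsilon>: "0 < \<epsilon>"
    have "edge_pt \<Gamma> e t \<in> mball (edge_pt \<Gamma> e s) \<epsilon>" if "t \<in> {0..len \<Gamma> e} \<inter> ball s \<epsilon>" for t
      using lip[of s t] that s edge_pt_in_points[OF assms]
      by (auto simp: in_mball dist_real_def abs_minus_commute)
    moreover have "s \<in> {0..len \<Gamma> e} \<inter> ball s \<epsilon>" using s \<epsilon> by simp
    moreover have "openin (top_of_set {0..len \<Gamma> e}) ({0..len \<Gamma> e} \<inter> ball s \<epsilon>)"
      by (intro openin_open_Int open_ball)
    ultimately show "\<exists>U. openin (top_of_set {0..len \<Gamma> e}) U \<and> s \<in> U \<and>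
        (\<forall>t\<in>U. edge_pt \<Gamma> e t \<in> mball (edge_pt \<Gamma> e s) \<epsilon>)" by blast
  qed
qed

lemma topspace_gtopology: "metric_graph \<Gamma> \<Longrightarrow> topspace (gtopology \<Gamma>) = points \<Gamma>"
  using Metric_space.topspace_mtopology[OF Metric_space_gdist] by blast

lemma compactin_imp_closedin_gtopology:
  "\<lbrakk>metric_graph \<Gamma>; compactin (gtopology \<Gamma>) K\<rbrakk> \<Longrightarrow> closedin (gtopology \<Gamma>) K"
  using compactin_imp_closedin Metric_space.Hausdorff_space_mtopology[OF Metric_space_gdist] by blast

text \<open>The complement of \<open>U\<close> is a finite union of images of compact parameter
  sets, hence closed in a Hausdorff space. The vertices outside \<open>U\<close> are added
  separately, so that a graph consisting of one vertex without edges is covered too.\<close>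

lemma openin_gtopologyI:
  assumes \<Gamma>: "metric_graph \<Gamma>" and U: "U \<subseteq> points \<Gamma>"
    and edge: "\<And>e. e \<in> edges \<Gamma> \<Longrightarrow>
      openin (top_of_set {0..len \<Gamma> e}) {t \<in> {0..len \<Gamma> e}. edge_pt \<Gamma> e t \<in> U}"
  shows "openin (gtopology \<Gamma>) U"
proof -
  define C where "C e = {0..len \<Gamma> e} - {t \<in> {0..len \<Gamma> e}. edge_pt \<Gamma> e t \<in> U}" for e
  have "closedin (gtopology \<Gamma>) (edge_pt \<Gamma> e ` C e)" if e: "e \<in> edges \<Gamma>" for e
  proof -
    have "closedin (top_of_set {0..len \<Gamma> e}) (C e)"
      using edge[OF e] by (simp add: C_def closedin_diff)
    then have "compactin (top_of_set {0..len \<Gamma> e}) (C e)"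
      using closedin_compact[OF compact_Icc] by (auto simp: compactin_subtopology C_def)
    from image_compactin[OF this continuous_map_edge_pt[OF \<Gamma> e]] show ?thesis
      by (rule compactin_imp_closedin_gtopology[OF \<Gamma>])
  qed
  moreover have "closedin (gtopology \<Gamma>) (Vertex ` verts (graph \<Gamma>) - U)"
  proof (intro compactin_imp_closedin_gtopology[OF \<Gamma>] finite_imp_compactin)
    show "Vertex ` verts (graph \<Gamma>) - U \<subseteq> topspace (gtopology \<Gamma>)"
      unfolding topspace_gtopology[OF \<Gamma>] by (auto simp: points_def)
  qed (use metric_graphD(1)[OF \<Gamma>] in simp)
  ultimately have "closedin (gtopology \<Gamma>)
      ((\<Union>e\<in>edges \<Gamma>. edge_pt \<Gamma> e ` C e) \<union> (Vertex ` verts (graph \<Gamma>) - U))"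
    using metric_graphD(2)[OF \<Gamma>] by (intro closedin_Un closedin_Union) auto
  also have "(\<Union>e\<in>edges \<Gamma>. edge_pt \<Gamma> e ` C e) \<union> (Vertex ` verts (graph \<Gamma>) - U) = points \<Gamma> - U"
  proof (rule equalityI)
    show "points \<Gamma> - U \<subseteq> (\<Union>e\<in>edges \<Gamma>. edge_pt \<Gamma> e ` C e) \<union> (Vertex ` verts (graph \<Gamma>) - U)"
    proof
      fix p assume p: "p \<in> points \<Gamma> - U"
      show "p \<in> (\<Union>e\<in>edges \<Gamma>. edge_pt \<Gamma> e ` C e) \<union> (Vertex ` verts (graph \<Gamma>) - U)"
      proof (cases p)
        case (Inner e t)
        then have e: "e \<in> edges \<Gamma>" "0 < t" "t < len \<Gamma> e" "edge_pt \<Gamma> e t = p"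
          using p by (auto simp: points_def edge_pt_def)
        then have "t \<in> C e" using p by (auto simp: C_def)
        then show ?thesis using e by blast
      qed (use p in \<open>auto simp: points_def\<close>)
    qed
  qed (use edge_pt_in_points[OF \<Gamma>] in \<open>auto simp: C_def points_def\<close>)
  finally show ?thesis using U by (simp add: openin_closedin_eq topspace_gtopology[OF \<Gamma>])
qed

lemma openin_points_minus_finite:
  assumes "metric_graph \<Gamma>" "finite F"
  shows "openin (gtopology \<Gamma>) (points \<Gamma> - F)"
proof -
  have "closedin (gtopology \<Gamma>) (points \<Gamma> \<inter> F)"
    using assms by (intro compactin_imp_closedin_gtopology finite_imp_compactin)
      (auto simp: topspace_gtopology)
  then show ?thesis using assms(1)
    by (simp add: closedin_def topspace_gtopology Diff_Int)
qed

lemma connectedin_edge_image: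
  assumes "metric_graph \<Gamma>" "e \<in> edges \<Gamma>" "topological_space_class.connected I" "I \<subseteq> {0..len \<Gamma> e}"
  shows "connectedin (gtopology \<Gamma>) (edge_pt \<Gamma> e ` I)"
  using assms
  by (intro connectedin_continuous_map_image[OF continuous_map_edge_pt])
    (auto simp: connectedin_subtopology)

text \<open>A clopen set contains each closed edge that it meets, hence everything joined by a path
  to one of its points.\<close>

lemma connected_space_gtopology:
  assumes \<Gamma>: "metric_graph \<Gamma>"
  shows "connected_space (gtopology \<Gamma>)"
  unfolding connected_space_clopen_in
proof (intro allI impI)
  fix T assume T: "openin (gtopology \<Gamma>) T \<and> closedin (gtopology \<Gamma>) T"
  then have sub: "T \<subseteq> points \<Gamma>" using closedin_subset topspace_gtopology[OF \<Gamma>] by fastforce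
  have step: "q \<in> T" if "path_length \<Gamma> p q l" "p \<in> T" for p q l
    using that
  proof (induction rule: path_length.induct)
    case (step p e s l t)
    have "edge_pt \<Gamma> e ` {0..len \<Gamma> e} \<subseteq> T \<or> disjnt (edge_pt \<Gamma> e ` {0..len \<Gamma> e}) T"
      using T connectedin_edge_image[OF \<Gamma> step.hyps(2), of "{0..len \<Gamma> e}"]
      by (intro connectedin_clopen_cases) auto
    moreover have "edge_pt \<Gamma> e s \<in> edge_pt \<Gamma> e ` {0..len \<Gamma> e} \<inter> T"
      using step.hyps(3) step.IH[OF step.prems] by blast
    ultimately show ?case using step.hyps(4) by (auto simp: disjnt_def)
  qed
  show "T = {} \<or> T = topspace (gtopology \<Gamma>)"
    using step path_length_ex[OF \<Gamma>] sub topspace_gtopology[OF \<Gamma>] by blast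
qed

section \<open>Finiteness of the set of components\<close>

lemma finite_inner_parameters:
  assumes "D \<in> divisors \<Gamma>"
  shows "finite {s. Inner e s \<in> supp D}"
proof -
  have "finite (Inner e -` supp D)"
    using assms by (intro finite_vimageI) (auto simp: divisors_def inj_def)
  then show ?thesis by (simp add: vimage_def)
qed

text \<open>\<open>P\<close> holds the breakpoints of the edge: its ends and the parameters of
  \<open>supp D\<close>. The neighbours \<open>a\<close> and \<open>b\<close> of \<open>t\<close> in
  \<open>P\<close> bound a connected piece avoiding \<open>supp D\<close>.\<close>

lemma edge_piece:
  assumes \<Gamma>: "metric_graph \<Gamma>" and D: "D \<in> divisors \<Gamma>" and p: "Inner e t \<in> points \<Gamma> - supp D"
    and P: "P = {0, len \<Gamma> e} \<union> {s. Inner e s \<in> supp D}"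
  shows "\<exists>a\<in>P. \<exists>b\<in>P. Inner e t \<in> edge_pt \<Gamma> e ` {a<..<b} \<and>
    connectedin (subtopology (gtopology \<Gamma>) (points \<Gamma> - supp D)) (edge_pt \<Gamma> e ` {a<..<b})"
proof -
  have t: "e \<in> edges \<Gamma>" "0 < t" "t < len \<Gamma> e" and tP: "t \<notin> P"
    using p by (auto simp: points_def P)
  have P01: "0 \<in> P" "len \<Gamma> e \<in> P" by (auto simp: P)
  have fin: "finite P" using finite_inner_parameters[OF D] P by auto
  define a where "a = Max {x \<in> P. x < t}"
  define b where "b = Min {x \<in> P. t < x}"
  have "a \<in> {x \<in> P. x < t}" unfolding a_def by (rule Max_in) (use fin P01 t in auto)
  then have a: "a \<in> P" "a < t" by auto
  have "b \<in> {x \<in> P. t < x}" unfolding b_def by (rule Min_in) (use fin P01 t in auto)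
  then have b: "b \<in> P" "t < b" by auto
  have a0: "0 \<le> a" unfolding a_def using fin P01 t by (intro Max_ge) auto
  have bL: "b \<le> len \<Gamma> e" unfolding b_def using fin P01 t by (intro Min_le) auto
  have gap: "s \<notin> P" if "s \<in> {a<..<b}" for s
  proof
    assume "s \<in> P"
    moreover have "s \<noteq> t" using \<open>s \<in> P\<close> tP by blast
    ultimately consider "s \<in> {x \<in> P. x < t}" | "s \<in> {x \<in> P. t < x}" by fastforce
    then have "s \<le> a \<or> b \<le> s" unfolding a_def b_def using fin by cases auto
    then show False using that by auto
  qed
  have inner: "edge_pt \<Gamma> e s = Inner e s" if "s \<in> {a<..<b}" for s
    using that a0 bL by (auto simp: edge_pt_def)
  have "edge_pt \<Gamma> e ` {a<..<b} \<subseteq> points \<Gamma> - supp D"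
    using inner gap edge_pt_in_points[OF \<Gamma> t(1)] by (fastforce simp: P)
  moreover have "connectedin (gtopology \<Gamma>) (edge_pt \<Gamma> e ` {a<..<b})"
    using a0 bL by (intro connectedin_edge_image[OF \<Gamma> t(1)]) auto
  moreover have "Inner e t \<in> edge_pt \<Gamma> e ` {a<..<b}"
    using inner[of t] a b by (intro image_eqI[of _ _ t]) auto
  ultimately show ?thesis using a b by (auto simp: connectedin_subtopology)
qed

text \<open>Each component contains a nonempty piece from a finite list, and different components,
  being disjoint, contain different pieces.\<close>

lemma finite_supp_complement_components:
  assumes \<Gamma>: "metric_graph \<Gamma>" and D: "D \<in> divisors \<Gamma>"
  shows "finite (supp_complement_components \<Gamma> D)"
proof -
  let ?X = "subtopology (gtopology \<Gamma>) (points \<Gamma> - supp D)"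
  define P where "P e = {0, len \<Gamma> e} \<union> {s. Inner e s \<in> supp D}" for e
  \<comment> \<open>Single vertices and the intervals between any two breakpoints; the gaps found by
    \<open>edge_piece\<close> are among them.\<close>
  define \<K> where "\<K> = (\<lambda>v. {Vertex v}) ` verts (graph \<Gamma>) \<union>
    (\<lambda>(e, a, b). edge_pt \<Gamma> e ` {a<..<b}) ` (SIGMA e:edges \<Gamma>. P e \<times> P e)"
  have "finite (P e)" for e using finite_inner_parameters[OF D] by (auto simp: P_def)
  then have fin: "finite \<K>"
    using metric_graphD(1,2)[OF \<Gamma>] unfolding \<K>_def
    by (intro finite_UnI finite_imageI finite_SigmaI finite_cartesian_product) auto
  have top: "topspace ?X = points \<Gamma> - supp D" by (auto simp: topspace_gtopology[OF \<Gamma>])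
  have "\<exists>K\<in>\<K>. K \<noteq> {} \<and> K \<subseteq> S" if S: "S \<in> connected_components_of ?X" for S
  proof -
    obtain p where p: "p \<in> S" using nonempty_connected_components_of[OF S] by blast
    then have pD: "p \<in> points \<Gamma> - supp D" using connected_components_of_subset[OF S] top by blast
    have "\<exists>K\<in>\<K>. p \<in> K \<and> connectedin ?X K"
    proof (cases p)
      case (Vertex v)
      then have "{p} \<in> \<K>" using pD by (auto simp: \<K>_def points_def)
      then show ?thesis using pD top by (intro bexI[of _ "{p}"]) auto
    next
      case (Inner e t)
      then have e: "e \<in> edges \<Gamma>" using pD by (auto simp: points_def)
      obtain a b where "a \<in> P e" "b \<in> P e" "p \<in> edge_pt \<Gamma> e ` {a<..<b}"
        "connectedin ?X (edge_pt \<Gamma> e ` {a<..<b})"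
        using edge_piece[OF \<Gamma> D _ P_def, of e t] pD Inner by blast
      moreover from this e have "edge_pt \<Gamma> e ` {a<..<b} \<in> \<K>"
        unfolding \<K>_def by (intro UnI2 image_eqI[of _ _ "(e, a, b)"]) auto
      ultimately show ?thesis by blast
    qed
    then obtain K where K: "K \<in> \<K>" "p \<in> K" "connectedin ?X K" by blast
    then have "K \<subseteq> S" using connected_components_of_maximal[OF S] p by (auto simp: disjnt_def)
    then show ?thesis using K by blast
  qed
  then obtain g where g: "\<And>S. S \<in> connected_components_of ?X \<Longrightarrow> g S \<in> \<K> \<and> g S \<noteq> {} \<and> g S \<subseteq> S"
    by metis
  have "inj_on g (connected_components_of ?X)"
  proof (rule inj_onI)
    fix S T assume ST: "S \<in> connected_components_of ?X" "T \<in> connected_components_of ?X" "g S = g T"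
    then have "\<not> disjnt S T" using g[of S] g[of T] by (auto simp: disjnt_def)
    then show "S = T" using connected_components_of_disjoint ST by blast
  qed
  moreover have "g ` connected_components_of ?X \<subseteq> \<K>" using g by blast
  ultimately show ?thesis using fin inj_on_finite
    unfolding supp_complement_components_def by blast
qed


section \<open>Slopes and the minimum principle\<close>

lemma eventually_linear_zero:
  fixes b :: real
  assumes "\<forall>\<^sub>F h in at_right 0. b * h = 0"
  shows "b = 0"
proof -
  have "\<forall>\<^sub>F h :: real in at_right 0. b = 0"
    using assms eventually_at_right_less[of 0] by eventually_elim auto
  then show ?thesis by simp
qed

text \<open>Piecewise linearity only speaks of open intervals, so the formula beside
  \<open>t\<close> comes with an unknown constant; continuity identifies it as
  \<open>f t\<close>.\<close>

lemma piecewise_linear_one_sided: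
  fixes f :: "real \<Rightarrow> real"
  assumes pl: "piecewise_linear_on L f" and cont: "continuous_on {0..L} f"
    and t: "t \<in> {0..L}" and \<sigma>: "\<sigma> = 1 \<and> t < L \<or> \<sigma> = -1 \<and> 0 < t"
  shows "\<exists>m::int. \<forall>\<^sub>F h in at_right 0. f (t + \<sigma> * h) = f t + of_int m * h"
proof -
  obtain B where B: "finite B" and lin: "\<And>a b. \<lbrakk>0 \<le> a; a < b; b \<le> L; {a<..<b} \<inter> B = {}\<rbrakk>
      \<Longrightarrow> \<exists>(m::int) c. \<forall>t\<in>{a<..<b}. f t = of_int m * t + c"
    using pl unfolding piecewise_linear_on_def by blast
  have "\<exists>\<delta>>0. \<exists>(m::int) c. \<forall>h\<in>{0<..<\<delta>}. t + \<sigma> * h \<in> {0..L} \<and> f (t + \<sigma> * h) = of_int m * h + c"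
    using \<sigma>
  proof
    assume s: "\<sigma> = 1 \<and> t < L"
    \<comment> \<open>The next breakpoint to the right of \<open>t\<close>, with \<open>L\<close> as
      fallback; on the left, \<open>0\<close> plays this part.\<close>
    define b where "b = Min (insert L {x \<in> B. t < x})"
    have b: "t < b" "b \<le> L" using B s by (auto simp: b_def)
    have "{t<..<b} \<inter> B = {}" using B by (auto simp: b_def)
    then obtain m :: int and c where mc: "\<And>x. x \<in> {t<..<b} \<Longrightarrow> f x = of_int m * x + c"
      using lin[of t b] b t by auto
    have "t + \<sigma> * h \<in> {0..L} \<and> f (t + \<sigma> * h) = of_int m * h + (of_int m * t + c)"
      if "h \<in> {0<..<b - t}" for h
      using mc[of "t + h"] that b t s by (auto simp: algebra_simps)
    then show ?thesis using b by (intro exI[of _ "b - t"]) auto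
  next
    assume s: "\<sigma> = -1 \<and> 0 < t"
    define a where "a = Max (insert 0 {x \<in> B. x < t})"
    have a: "a < t" "0 \<le> a" using B s by (auto simp: a_def)
    have "{a<..<t} \<inter> B = {}" using B by (auto simp: a_def)
    then obtain m :: int and c where mc: "\<And>x. x \<in> {a<..<t} \<Longrightarrow> f x = of_int m * x + c"
      using lin[of a t] a t by auto
    have "t + \<sigma> * h \<in> {0..L} \<and> f (t + \<sigma> * h) = of_int (- m) * h + (of_int m * t + c)"
      if "h \<in> {0<..<t - a}" for h
      using mc[of "t - h"] that a t s by (auto simp: algebra_simps)
    then show ?thesis using a by (intro exI[of _ "t - a"]) (auto simp del: of_int_minus)
  qed
  then obtain \<delta> c and m :: int where \<delta>: "0 < \<delta>"
    and h: "\<And>h. h \<in> {0<..<\<delta>} \<Longrightarrow> t + \<sigma> * h \<in> {0..L} \<and> f (t + \<sigma> * h) = of_int m * h + c"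
    by blast
  have ev: "\<forall>\<^sub>F h in at_right 0. h \<in> {0<..<\<delta>}"
    using \<delta> by (rule eventually_at_right_real)
  have "((\<lambda>h. t + \<sigma> * h) \<longlongrightarrow> t + \<sigma> * 0) (at_right 0)" by (intro tendsto_intros)
  then have "((\<lambda>h. f (t + \<sigma> * h)) \<longlongrightarrow> f t) (at_right 0)"
    using t by (intro continuous_on_tendsto_compose[OF cont] eventually_mono[OF ev])
      (use h in auto)
  moreover have "((\<lambda>h. f (t + \<sigma> * h)) \<longlongrightarrow> of_int m * 0 + c) (at_right 0)"
  proof (rule Lim_transform_eventually)
    show "((\<lambda>h. of_int m * h + c) \<longlongrightarrow> of_int m * 0 + c) (at_right 0)" by (intro tendsto_intros)
    show "\<forall>\<^sub>F h in at_right 0. of_int m * h + c = f (t + \<sigma> * h)"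
      by (rule eventually_mono[OF ev]) (use h in auto)
  qed
  ultimately have "f t = c" using tendsto_unique[of "at_right (0::real)"] by fastforce
  then show ?thesis
    by (intro exI[of _ m] eventually_mono[OF ev]) (use h in auto)
qed

text \<open>The definite description is legitimate: two affine functions of \<open>h\<close> that
  agree for all small \<open>h > 0\<close> have the same slope.\<close>

lemma outgoing_slope_unique:
  assumes "\<forall>\<^sub>F h in at_right 0. \<phi> (edge_pt \<Gamma> e (t + \<sigma> * h)) = \<phi> (edge_pt \<Gamma> e t) + of_int m * h"
  shows "outgoing_slope \<Gamma> \<phi> (e, t, \<sigma>) = m"
  unfolding outgoing_slope_def prod.case
proof (rule the_equality)
  show "\<forall>\<^sub>F h in at_right 0. \<phi> (edge_pt \<Gamma> e (t + \<sigma> * h)) = \<phi> (edge_pt \<Gamma> e t) + of_int m * h"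
    by (rule assms)
  fix k :: int
  assume "\<forall>\<^sub>F h in at_right 0. \<phi> (edge_pt \<Gamma> e (t + \<sigma> * h)) = \<phi> (edge_pt \<Gamma> e t) + of_int k * h"
  then have "\<forall>\<^sub>F h in at_right 0. (of_int k - of_int m) * h = (0 :: real)"
    using assms by eventually_elim (simp add: algebra_simps)
  then have "of_int k - of_int m = (0 :: real)" by (rule eventually_linear_zero)
  then show "k = m" by simp
qed

lemma tangentsD:
  assumes "(e, t, \<sigma>) \<in> tangents \<Gamma> p"
  shows "e \<in> edges \<Gamma>" "t \<in> {0..len \<Gamma> e}" "edge_pt \<Gamma> e t = p"
    "\<sigma> = 1 \<and> t < len \<Gamma> e \<or> \<sigma> = -1 \<and> 0 < t"
  using assms by (auto simp: tangents_def)

lemma outgoing_slope: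
  assumes \<Gamma>: "metric_graph \<Gamma>" and \<phi>: "\<phi> \<in> PL \<Gamma>" and d: "(e, t, \<sigma>) \<in> tangents \<Gamma> p"
  shows "\<forall>\<^sub>F h in at_right 0.
    \<phi> (edge_pt \<Gamma> e (t + \<sigma> * h)) = \<phi> p + of_int (outgoing_slope \<Gamma> \<phi> (e, t, \<sigma>)) * h"
proof -
  have "continuous_map (top_of_set {0..len \<Gamma> e}) euclideanreal (\<phi> \<circ> edge_pt \<Gamma> e)"
    using \<phi> continuous_map_edge_pt[OF \<Gamma> tangentsD(1)[OF d]]
    by (intro continuous_map_compose) (auto simp: PL_def)
  then have "continuous_on {0..len \<Gamma> e} (\<lambda>t. \<phi> (edge_pt \<Gamma> e t))"
    by (simp add: continuous_map_iff_continuous comp_def)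
  moreover have "piecewise_linear_on (len \<Gamma> e) (\<lambda>t. \<phi> (edge_pt \<Gamma> e t))"
    using \<phi> tangentsD(1)[OF d] by (simp add: PL_def)
  ultimately obtain m :: int where
    "\<forall>\<^sub>F h in at_right 0. \<phi> (edge_pt \<Gamma> e (t + \<sigma> * h)) = \<phi> (edge_pt \<Gamma> e t) + of_int m * h"
    using piecewise_linear_one_sided tangentsD(2,4)[OF d] by blast
  then show ?thesis using outgoing_slope_unique[of \<phi> \<Gamma> e t \<sigma> m] tangentsD(3)[OF d] by simp
qed

lemma finite_tangents:
  assumes "metric_graph \<Gamma>"
  shows "finite (tangents \<Gamma> p)"
proof (rule finite_subset)
  \<comment> \<open>The only parameters at which \<open>p\<close> can lie on \<open>e\<close>; for a
    vertex the third entry is a dummy.\<close>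
  define P where "P e = {0, len \<Gamma> e, case p of Vertex v \<Rightarrow> 0 | Inner e' t \<Rightarrow> t}" for e
  show "tangents \<Gamma> p \<subseteq> (SIGMA e:edges \<Gamma>. P e \<times> {1, -1})"
    by (auto simp: tangents_def P_def edge_pt_def split: if_splits)
  show "finite (SIGMA e:edges \<Gamma>. P e \<times> {1, - 1 :: real})"
    using metric_graphD(2)[OF assms]
    by (intro finite_SigmaI finite_cartesian_product) (auto simp: P_def)
qed

lemma outgoing_slope_minimizer_nonneg:
  assumes \<Gamma>: "metric_graph \<Gamma>" and \<phi>: "\<phi> \<in> PL \<Gamma>" and p: "p \<in> minimizers \<Gamma> \<phi>"
    and d: "d \<in> tangents \<Gamma> p"
  shows "0 \<le> outgoing_slope \<Gamma> \<phi> d"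
proof -
  obtain e t \<sigma> where d': "d = (e, t, \<sigma>)" using prod_cases3 by blast
  have e: "e \<in> edges \<Gamma>" using tangentsD(1) d unfolding d' .
  have "\<forall>\<^sub>F h :: real in at_right 0. 0 \<le> outgoing_slope \<Gamma> \<phi> d"
    using outgoing_slope[OF \<Gamma> \<phi> d[unfolded d']] eventually_at_right_less[of 0]
  proof eventually_elim
    case (elim h)
    have "\<phi> p \<le> \<phi> (edge_pt \<Gamma> e (t + \<sigma> * h))"
      using p edge_pt_in_points[OF \<Gamma> e] by (simp add: minimizers_def)
    then have "0 \<le> of_int (outgoing_slope \<Gamma> \<phi> d) * h" using elim d' by simp
    then show ?case using elim(2) by (simp add: zero_le_mult_iff)
  qed
  then show ?thesis by simp
qed

lemma pl_div_minimizer_nonpos: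
  assumes "metric_graph \<Gamma>" "\<phi> \<in> PL \<Gamma>" "p \<in> minimizers \<Gamma> \<phi>"
  shows "pl_div \<Gamma> \<phi> p \<le> 0"
  using outgoing_slope_minimizer_nonneg[OF assms] by (simp add: pl_div_def sum_nonneg)

text \<open>Outgoing slopes at a minimizer are nonnegative, and the hypothesis on
  \<open>pl_div\<close> makes their sum at most \<open>0\<close>.\<close>

lemma outgoing_slope_minimizer_zero:
  assumes "metric_graph \<Gamma>" "\<phi> \<in> PL \<Gamma>" "p \<in> minimizers \<Gamma> \<phi>" "0 \<le> pl_div \<Gamma> \<phi> p"
    and "d \<in> tangents \<Gamma> p"
  shows "outgoing_slope \<Gamma> \<phi> d = 0"
proof -
  have "(\<Sum>d\<in>tangents \<Gamma> p. outgoing_slope \<Gamma> \<phi> d) = 0"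
    using pl_div_minimizer_nonpos[OF assms(1-3)] assms(4) by (simp add: pl_div_def)
  then show ?thesis
    using sum_nonneg_eq_0_iff[OF finite_tangents[OF assms(1)]]
      outgoing_slope_minimizer_nonneg[OF assms(1-3)] assms(5) by blast
qed

section \<open>The minimum principle for functions in \<open>Rmod\<close>\<close>

lemma Rmod_PL: "\<phi> \<in> Rmod \<Gamma> D \<Longrightarrow> \<phi> \<in> PL \<Gamma>"
  by (simp add: Rmod_def)

lemma Rmod_effective: "\<phi> \<in> Rmod \<Gamma> D \<Longrightarrow> 0 \<le> D p + pl_div \<Gamma> \<phi> p"
  by (simp add: Rmod_def effective_def)

text \<open>Off \<open>supp D\<close> effectivity makes \<open>pl_div\<close> nonnegative, so all
  slopes at a minimizer vanish and the function is constant nearby on each edge.\<close>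

lemma openin_minimizers:
  assumes \<Gamma>: "metric_graph \<Gamma>" and D: "D \<in> divisors \<Gamma>" and \<phi>: "\<phi> \<in> Rmod \<Gamma> D"
  shows "openin (gtopology \<Gamma>) (minimizers \<Gamma> \<phi> - supp D)"
proof (rule openin_gtopologyI[OF \<Gamma>])
  show "minimizers \<Gamma> \<phi> - supp D \<subseteq> points \<Gamma>" by (auto simp: minimizers_def)
  fix e assume e: "e \<in> edges \<Gamma>"
  let ?L = "len \<Gamma> e"
  have off_supp: "openin (top_of_set {0..?L}) {t \<in> {0..?L}. edge_pt \<Gamma> e t \<in> points \<Gamma> - supp D}"
    using openin_continuous_map_preimage[OF continuous_map_edge_pt[OF \<Gamma> e]
        openin_points_minus_finite[OF \<Gamma>, of "supp D"]] D
    by (simp add: divisors_def)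
  show "openin (top_of_set {0..?L}) {t \<in> {0..?L}. edge_pt \<Gamma> e t \<in> minimizers \<Gamma> \<phi> - supp D}"
    unfolding openin_euclidean_subtopology_iff
  proof (intro conjI ballI)
    fix t assume t: "t \<in> {t \<in> {0..?L}. edge_pt \<Gamma> e t \<in> minimizers \<Gamma> \<phi> - supp D}"
    let ?p = "edge_pt \<Gamma> e t"
    have p: "?p \<in> minimizers \<Gamma> \<phi>" "?p \<notin> supp D" using t by auto
    have "0 \<le> pl_div \<Gamma> \<phi> ?p" using Rmod_effective[OF \<phi>, of ?p] p(2) by (simp add: supp_def)
    note slope0 = outgoing_slope_minimizer_zero[OF \<Gamma> Rmod_PL[OF \<phi>] p(1) this]
    have "t \<in> {t \<in> {0..?L}. edge_pt \<Gamma> e t \<in> points \<Gamma> - supp D}"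
      using t edge_pt_in_points[OF \<Gamma> e] by simp
    then have "\<exists>\<delta>0>0. \<forall>s\<in>{0..?L}. dist s t < \<delta>0 \<longrightarrow>
        s \<in> {t \<in> {0..?L}. edge_pt \<Gamma> e t \<in> points \<Gamma> - supp D}"
      using off_supp unfolding openin_euclidean_subtopology_iff by blast
    then obtain \<delta>0 where \<delta>0: "0 < \<delta>0"
      "\<And>s. s \<in> {0..?L} \<Longrightarrow> dist s t < \<delta>0 \<Longrightarrow> edge_pt \<Gamma> e s \<in> points \<Gamma> - supp D"
      by blast
    have "\<exists>\<delta>>0. \<forall>h. 0 < h \<and> h < \<delta> \<and> t + \<sigma> * h \<in> {0..?L} \<longrightarrow> \<phi> (edge_pt \<Gamma> e (t + \<sigma> * h)) = \<phi> ?p"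
      if \<sigma>: "\<sigma> \<in> {1, -1}" for \<sigma> :: real
    proof (cases "(e, t, \<sigma>) \<in> tangents \<Gamma> ?p")
      case True
      then have "\<forall>\<^sub>F h in at_right 0. \<phi> (edge_pt \<Gamma> e (t + \<sigma> * h)) = \<phi> ?p"
        using outgoing_slope[OF \<Gamma> Rmod_PL[OF \<phi>] True] slope0[OF True] by simp
      then show ?thesis by (auto simp: eventually_at_right_field)
    next
      \<comment> \<open>At an end of the edge the outward direction is not a tangent direction, and
        the claim is vacuous.\<close>
      case False
      then have "t + \<sigma> * h \<notin> {0..?L}" if "0 < h" for h
        using \<sigma> e t that by (auto simp: tangents_def)
      then show ?thesis using zero_less_one by blast
    qed
    from this[of 1] this[of "-1"] obtain \<delta>1 \<delta>2 where \<delta>: "0 < \<delta>1" "0 < \<delta>2"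
      "\<And>h. \<lbrakk>0 < h; h < \<delta>1; t + h \<in> {0..?L}\<rbrakk> \<Longrightarrow> \<phi> (edge_pt \<Gamma> e (t + h)) = \<phi> ?p"
      "\<And>h. \<lbrakk>0 < h; h < \<delta>2; t - h \<in> {0..?L}\<rbrakk> \<Longrightarrow> \<phi> (edge_pt \<Gamma> e (t - h)) = \<phi> ?p"
      by auto
    have "edge_pt \<Gamma> e s \<in> minimizers \<Gamma> \<phi> - supp D"
      if s: "s \<in> {0..?L}" "dist s t < min \<delta>0 (min \<delta>1 \<delta>2)" for s
    proof -
      have "\<phi> (edge_pt \<Gamma> e s) = \<phi> ?p"
      proof (cases rule: linorder_cases[of s t])
        case less
        then show ?thesis using \<delta>(4)[of "t - s"] s by (simp add: dist_real_def)
      next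
        case greater
        then show ?thesis using \<delta>(3)[of "s - t"] s by (simp add: dist_real_def)
      qed simp
      then show ?thesis using p(1) \<delta>0(2)[OF s(1)] s(2) by (auto simp: minimizers_def)
    qed
    then show "\<exists>\<delta>>0. \<forall>s\<in>{0..?L}. dist s t < \<delta> \<longrightarrow>
        s \<in> {t \<in> {0..?L}. edge_pt \<Gamma> e t \<in> minimizers \<Gamma> \<phi> - supp D}"
      using \<delta>0(1) \<delta>(1,2) by (intro exI[of _ "min \<delta>0 (min \<delta>1 \<delta>2)"]) auto
  qed auto
qed

text \<open>The minimizers off \<open>supp D\<close> form an open set, the non-minimizers form an
  open set by continuity, and together they cover \<open>S\<close>. With the zero divisor this also
  applies to the whole graph.\<close>

lemma minimum_principle:
  assumes \<Gamma>: "metric_graph \<Gamma>" and D: "D \<in> divisors \<Gamma>" and \<phi>: "\<phi> \<in> Rmod \<Gamma> D"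
    and S: "connectedin (gtopology \<Gamma>) S" "S \<inter> supp D = {}"
  shows "S \<subseteq> minimizers \<Gamma> \<phi> \<or> S \<inter> minimizers \<Gamma> \<phi> = {}"
proof (rule ccontr)
  assume neg: "\<not> (S \<subseteq> minimizers \<Gamma> \<phi> \<or> S \<inter> minimizers \<Gamma> \<phi> = {})"
  then obtain q where q: "q \<in> minimizers \<Gamma> \<phi>" by blast
  have above: "{p \<in> points \<Gamma>. \<phi> p \<in> {\<phi> q<..}} = points \<Gamma> - minimizers \<Gamma> \<phi>"
    using q by (fastforce simp: minimizers_def)
  have "continuous_map (gtopology \<Gamma>) euclideanreal \<phi>" using Rmod_PL[OF \<phi>] by (simp add: PL_def)
  from openin_continuous_map_preimage[OF this, of "{\<phi> q<..}"]
  have "openin (gtopology \<Gamma>) (points \<Gamma> - minimizers \<Gamma> \<phi>)"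
    using above by (simp add: topspace_gtopology[OF \<Gamma>])
  moreover have "S \<subseteq> points \<Gamma>"
    using connectedin_subset_topspace[OF S(1)] topspace_gtopology[OF \<Gamma>] by simp
  ultimately show False
    using connectedinD[OF S(1) openin_minimizers[OF \<Gamma> D \<phi>]] S(2) neg by blast
qed


section \<open>Submodules with big minimizers\<close>

text \<open>Applied to the condition in \<open>r_BN\<close>, this shows that the greatest integer
  satisfies the condition itself.\<close>

lemma Greatest_int:
  fixes P :: "int \<Rightarrow> bool"
  assumes "P k" and "\<And>n. P n \<Longrightarrow> n \<le> N"
  shows "P (Greatest P)"
proof -
  let ?A = "{n \<in> {k..N}. P n}"
  have "k \<in> ?A" using assms by simp
  moreover have "finite ?A" by (rule finite_subset[of _ "{k..N}"]) auto
  ultimately have mem: "Max ?A \<in> ?A" by (intro Max_in) auto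
  have "n \<le> Max ?A" if "P n" for n
  proof (cases "k \<le> n")
    case True
    then show ?thesis using that assms(2) \<open>finite ?A\<close> by (intro Max_ge) auto
  next
    case False
    then show ?thesis using mem by auto
  qed
  then have "Greatest P = Max ?A" using mem by (intro Greatest_equality) auto
  then show ?thesis using mem by simp
qed

lemma degree_count: "degree (\<lambda>p. int (count M p)) = int (size M)"
proof -
  have "supp (\<lambda>p. int (count M p)) = set_mset M" by (auto simp: supp_def)
  then show ?thesis by (simp add: degree_def size_multiset_overloaded_eq)
qed

text \<open>The two rank conditions are not locale assumptions; they enter through
  \<open>Fset_chain_card\<close> and \<open>Fset_cover\<close>.\<close>

locale big_minimizers_module =
  fixes \<Gamma> :: "('v, 'e) mgraph" and D :: "('v, 'e) gpoint \<Rightarrow> int"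
    and \<Sigma> :: "(('v, 'e) gpoint \<Rightarrow> real) set" and E :: "('v, 'e) gpoint set set"
  assumes \<Gamma>: "metric_graph \<Gamma>" and D: "D \<in> divisors \<Gamma>"
    and submodule: "tropical_submodule \<Gamma> D \<Sigma>"
    and big: "big_minimizers \<Gamma> D \<Sigma>"
    and E: "E = supp_complement_components \<Gamma> D"
begin

lemma finite_components: "finite E"
  unfolding E by (rule finite_supp_complement_components[OF \<Gamma> D])

lemma component_nonempty: "S \<in> E \<Longrightarrow> S \<noteq> {}"
  unfolding E supp_complement_components_def by (rule nonempty_connected_components_of)

lemma Union_components: "\<Union>E = points \<Gamma> - supp D"
  by (auto simp: E supp_complement_components_def Union_connected_components_of
      topspace_gtopology[OF \<Gamma>])

lemma series_Rmod: "\<phi> \<in> \<Sigma> \<Longrightarrow> \<phi> \<in> Rmod \<Gamma> D"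
  using submodule by (auto simp: tropical_submodule_def)

lemma component_minimizers:
  assumes "\<phi> \<in> \<Sigma>" "S \<in> E"
  shows "S \<subseteq> minimizers \<Gamma> \<phi> \<or> S \<inter> minimizers \<Gamma> \<phi> = {}"
proof (rule minimum_principle[OF \<Gamma> D series_Rmod[OF assms(1)]])
  show "connectedin (gtopology \<Gamma>) S"
    using connectedin_connected_components_of assms(2) connectedin_subtopology
    unfolding E supp_complement_components_def by blast
  show "S \<inter> supp D = {}" using Union_components assms(2) by blast
qed

text \<open>By the minimum principle, a component not inside the minimizers misses them altogether.
  This turns unions of sets of minimizers into intersections of the sets
  \<open>Fset\<close>.\<close>

lemma Fset_iff:
  assumes "\<phi> \<in> \<Sigma>"
  shows "S \<in> Fset \<Gamma> D \<phi> \<longleftrightarrow> S \<in> E \<and> S \<inter> minimizers \<Gamma> \<phi> = {}"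
  using component_minimizers[OF assms, of S] component_nonempty[of S]
  by (auto simp: Fset_def E)

lemma component_in_minimizers: "\<phi> \<in> \<Sigma> \<Longrightarrow> \<exists>S\<in>E. S \<subseteq> minimizers \<Gamma> \<phi>"
  using big by (simp add: big_minimizers_def E)

lemma minimizer_exists:
  assumes "\<phi> \<in> \<Sigma>"
  shows "\<exists>p. p \<in> minimizers \<Gamma> \<phi>"
proof -
  obtain S where "S \<in> E" "S \<subseteq> minimizers \<Gamma> \<phi>" using component_in_minimizers[OF assms] by blast
  then show ?thesis using component_nonempty[of S] by blast
qed

lemma Fset_proper:
  assumes "\<phi> \<in> \<Sigma>"
  shows "Fset \<Gamma> D \<phi> \<subset> E"
  using component_in_minimizers[OF assms] by (auto simp: Fset_def E)

lemma Fset_Int: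
  assumes \<phi>: "\<phi> \<in> \<Sigma>" and \<psi>: "\<psi> \<in> \<Sigma>"
  shows "\<exists>\<omega>\<in>\<Sigma>. Fset \<Gamma> D \<omega> = Fset \<Gamma> D \<phi> \<inter> Fset \<Gamma> D \<psi>"
proof -
  obtain p where p: "p \<in> minimizers \<Gamma> \<phi>" using minimizer_exists[OF \<phi>] by blast
  obtain q where q: "q \<in> minimizers \<Gamma> \<psi>" using minimizer_exists[OF \<psi>] by blast
  \<comment> \<open>The shift makes both minimum values equal to \<open>\<phi> p\<close>, so the
    pointwise minimum has the minimizers of both functions.\<close>
  define \<psi>' where "\<psi>' = (\<lambda>x\<in>points \<Gamma>. \<psi> x + (\<phi> p - \<psi> q))"
  define \<omega> where "\<omega> = (\<lambda>x\<in>points \<Gamma>. min (\<phi> x) (\<psi>' x))"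
  have "\<psi>' \<in> \<Sigma>" using submodule \<psi> unfolding tropical_submodule_def \<psi>'_def by blast
  then have \<omega>: "\<omega> \<in> \<Sigma>" using submodule \<phi> unfolding tropical_submodule_def \<omega>_def by blast
  have pts: "p \<in> points \<Gamma>" "q \<in> points \<Gamma>" using p q by (auto simp: minimizers_def)
  have min\<phi>: "x \<in> minimizers \<Gamma> \<phi> \<longleftrightarrow> x \<in> points \<Gamma> \<and> \<phi> x \<le> \<phi> p" for x
    using p by (fastforce simp: minimizers_def)
  have min\<psi>: "x \<in> minimizers \<Gamma> \<psi> \<longleftrightarrow> x \<in> points \<Gamma> \<and> \<psi> x \<le> \<psi> q" for x
    using q by (fastforce simp: minimizers_def)
  have \<omega>_eq: "\<omega> x = min (\<phi> x) (\<psi> x + (\<phi> p - \<psi> q))" if "x \<in> points \<Gamma>" for x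
    using that by (simp add: \<omega>_def \<psi>'_def)
  have "\<omega> p = \<phi> p" using pts p q by (auto simp: \<omega>_eq minimizers_def)
  moreover have "\<phi> p \<le> \<omega> x" if "x \<in> points \<Gamma>" for x
    using that p q by (auto simp: \<omega>_eq minimizers_def)
  ultimately have min\<omega>: "x \<in> minimizers \<Gamma> \<omega> \<longleftrightarrow> x \<in> points \<Gamma> \<and> \<omega> x \<le> \<phi> p" for x
    using pts(1) by (fastforce simp: minimizers_def)
  have "\<omega> x \<le> \<phi> p \<longleftrightarrow> \<phi> x \<le> \<phi> p \<or> \<psi> x \<le> \<psi> q" if "x \<in> points \<Gamma>" for x
    using \<omega>_eq[OF that] by linarith
  then have "minimizers \<Gamma> \<omega> = minimizers \<Gamma> \<phi> \<union> minimizers \<Gamma> \<psi>"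
    by (intro set_eqI) (simp only: Un_iff min\<phi> min\<psi> min\<omega>, blast)
  then have "Fset \<Gamma> D \<omega> = Fset \<Gamma> D \<phi> \<inter> Fset \<Gamma> D \<psi>"
    by (auto simp: Fset_iff \<phi> \<psi> \<omega>)
  then show ?thesis using \<omega> by blast
qed

section \<open>Chains and tropical independence\<close>

lemma Fset_chain_least:
  assumes "finite T" "T \<noteq> {}"
    and "\<And>\<phi> \<psi>. \<lbrakk>\<phi> \<in> T; \<psi> \<in> T\<rbrakk> \<Longrightarrow> Fset \<Gamma> D \<phi> \<subseteq> Fset \<Gamma> D \<psi> \<or> Fset \<Gamma> D \<psi> \<subseteq> Fset \<Gamma> D \<phi>"
  obtains \<phi> where "\<phi> \<in> T" "\<And>\<psi>. \<psi> \<in> T \<Longrightarrow> Fset \<Gamma> D \<phi> \<subseteq> Fset \<Gamma> D \<psi>"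
proof -
  obtain F where F: "F \<in> Fset \<Gamma> D ` T" "\<And>G. \<lbrakk>G \<in> Fset \<Gamma> D ` T; G \<subseteq> F\<rbrakk> \<Longrightarrow> F = G"
    using finite_has_minimal[of "Fset \<Gamma> D ` T"] assms(1,2) by auto
  then obtain \<phi> where "\<phi> \<in> T" "F = Fset \<Gamma> D \<phi>" by blast
  then show thesis using that[of \<phi>] F(2) assms(3) by blast
qed

text \<open>
  Among the summands whose minimum value is smallest, the one with the largest set of minimizers
  attains the tropical sum alone on some component.
\<close>

lemma Fset_chain_independent:
  assumes T: "finite T" "T \<noteq> {}" "T \<subseteq> \<Sigma>" and inj: "inj_on (Fset \<Gamma> D) T"
    and chain: "\<And>\<phi> \<psi>. \<lbrakk>\<phi> \<in> T; \<psi> \<in> T\<rbrakk> \<Longrightarrow> Fset \<Gamma> D \<phi> \<subseteq> Fset \<Gamma> D \<psi> \<or> Fset \<Gamma> D \<psi> \<subseteq> Fset \<Gamma> D \<phi>"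
  shows "\<not> tropically_dependent \<Gamma> T"
proof
  assume "tropically_dependent \<Gamma> T"
  then obtain a where a: "\<And>p. p \<in> points \<Gamma> \<Longrightarrow>
      2 \<le> card {\<phi> \<in> T. \<phi> p + a \<phi> = (MIN \<psi>\<in>T. \<psi> p + a \<psi>)}"
    unfolding tropically_dependent_def by blast
  have "\<forall>\<phi>\<in>T. \<exists>p. p \<in> minimizers \<Gamma> \<phi>" using T(3) minimizer_exists by blast
  then obtain m where m: "\<And>\<phi>. \<phi> \<in> T \<Longrightarrow> m \<phi> \<in> minimizers \<Gamma> \<phi>" by metis
  \<comment> \<open>\<open>v \<phi>\<close> is the minimum value of the summand with coefficient
    \<open>a \<phi>\<close>; \<open>K\<close> collects the summands whose minimum value is the
    smallest.\<close>
  define v where "v \<phi> = \<phi> (m \<phi>) + a \<phi>" for \<phi>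
  define c where "c = Min (v ` T)"
  define K where "K = {\<phi> \<in> T. v \<phi> = c}"
  have c_le: "c \<le> v \<phi>" if "\<phi> \<in> T" for \<phi> using that T by (simp add: c_def)
  have "c \<in> v ` T" unfolding c_def using T by (intro Min_in) auto
  then have K: "K \<noteq> {}" "finite K" "K \<subseteq> T" using T by (auto simp: K_def)
  obtain \<phi>0 where \<phi>0: "\<phi>0 \<in> K" "\<And>\<psi>. \<psi> \<in> K \<Longrightarrow> Fset \<Gamma> D \<phi>0 \<subseteq> Fset \<Gamma> D \<psi>"
    using Fset_chain_least[OF K(2,1)] chain K(3) by blast
  have \<phi>0\<Sigma>: "\<phi>0 \<in> \<Sigma>" using \<phi>0(1) K(3) T(3) by blast
  have "\<exists>S\<in>E. S \<subseteq> minimizers \<Gamma> \<phi>0 \<and> (\<forall>\<psi>\<in>K - {\<phi>0}. S \<in> Fset \<Gamma> D \<psi>)"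
  \<comment> \<open>If \<open>\<phi>0\<close> is alone in \<open>K\<close>, big minimizers supply
    \<open>S\<close>. Otherwise \<open>\<psi>1\<close> is the next function of the chain, and a
    component in its \<open>Fset\<close> but not in that of \<open>\<phi>0\<close> lies in the
    \<open>Fset\<close> of all the others.\<close>
  proof (cases "K - {\<phi>0} = {}")
    case True
    then show ?thesis using component_in_minimizers[OF \<phi>0\<Sigma>] by blast
  next
    case False
    obtain \<psi>1 where \<psi>1: "\<psi>1 \<in> K - {\<phi>0}"
      "\<And>\<psi>. \<psi> \<in> K - {\<phi>0} \<Longrightarrow> Fset \<Gamma> D \<psi>1 \<subseteq> Fset \<Gamma> D \<psi>"
      using Fset_chain_least[OF _ False] chain K(2,3) by blast
    have "Fset \<Gamma> D \<phi>0 \<noteq> Fset \<Gamma> D \<psi>1"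
      using inj_onD[OF inj, of \<phi>0 \<psi>1] \<psi>1(1) \<phi>0(1) K(3) by blast
    then obtain S where S: "S \<in> Fset \<Gamma> D \<psi>1" "S \<notin> Fset \<Gamma> D \<phi>0"
      using \<phi>0(2)[of \<psi>1] \<psi>1(1) by blast
    then have "S \<in> E" "S \<subseteq> minimizers \<Gamma> \<phi>0" by (auto simp: Fset_def E)
    then show ?thesis using S(1) \<psi>1(2) by blast
  qed
  then obtain S where S: "S \<in> E" "S \<subseteq> minimizers \<Gamma> \<phi>0"
    "\<And>\<psi>. \<psi> \<in> K - {\<phi>0} \<Longrightarrow> S \<in> Fset \<Gamma> D \<psi>" by blast
  obtain p where p: "p \<in> S" using component_nonempty[OF S(1)] by blast
  have pp: "p \<in> points \<Gamma>" using p S(2) by (auto simp: minimizers_def)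
  have m_le: "\<psi> (m \<psi>) \<le> \<psi> p" if "\<psi> \<in> T" for \<psi> using m[OF that] pp by (simp add: minimizers_def)
  have "m \<phi>0 \<in> points \<Gamma>" using m[of \<phi>0] \<phi>0(1) K(3) by (auto simp: minimizers_def)
  then have "\<phi>0 p \<le> \<phi>0 (m \<phi>0)" using p S(2) by (auto simp: minimizers_def)
  then have val0: "\<phi>0 p + a \<phi>0 = c" using m_le[of \<phi>0] \<phi>0(1) by (auto simp: K_def v_def)
  \<comment> \<open>Inside \<open>K\<close> the value at \<open>p\<close> exceeds \<open>c\<close>
    because \<open>S\<close> misses the minimizers of \<open>\<psi>\<close>; outside
    \<open>K\<close> already the minimum value of the summand does.\<close>
  have val: "c < \<psi> p + a \<psi>" if \<psi>: "\<psi> \<in> T" "\<psi> \<noteq> \<phi>0" for \<psi>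
  proof (cases "\<psi> \<in> K")
    case True
    then have "p \<notin> minimizers \<Gamma> \<psi>" using S(3)[of \<psi>] \<psi> p T(3) Fset_iff[of \<psi> S] by auto
    then have "\<psi> p \<noteq> \<psi> (m \<psi>)" using m[OF \<psi>(1)] pp by (auto simp: minimizers_def)
    then show ?thesis using m_le[OF \<psi>(1)] True by (auto simp: K_def v_def)
  next
    case False
    then have "c < v \<psi>" using c_le[OF \<psi>(1)] \<psi>(1) by (auto simp: K_def)
    then show ?thesis using m_le[OF \<psi>(1)] by (simp add: v_def)
  qed
  have "(MIN \<psi>\<in>T. \<psi> p + a \<psi>) = c"
  proof (rule Min_eqI)
    have "c \<le> \<psi> p + a \<psi>" if "\<psi> \<in> T" for \<psi>
      using val[OF that] val0 by (cases "\<psi> = \<phi>0") auto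
    then show "c \<le> y" if "y \<in> (\<lambda>\<psi>. \<psi> p + a \<psi>) ` T" for y using that by blast
    show "c \<in> (\<lambda>\<psi>. \<psi> p + a \<psi>) ` T"
      using val0 \<phi>0(1) K(3) by (intro image_eqI[of _ _ \<phi>0]) auto
  qed (use T(1) in simp)
  moreover have "\<phi> = \<phi>0" if "\<phi> \<in> T" "\<phi> p + a \<phi> = c" for \<phi>
    using val[OF that(1)] that(2) by fastforce
  ultimately have "{\<phi> \<in> T. \<phi> p + a \<phi> = (MIN \<psi>\<in>T. \<psi> p + a \<psi>)} \<subseteq> {\<phi>0}" by auto
  from card_mono[OF _ this]
  have "card {\<phi> \<in> T. \<phi> p + a \<phi> = (MIN \<psi>\<in>T. \<psi> p + a \<psi>)} \<le> 1" by simp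
  then show False using a[OF pp] by simp
qed

text \<open>One function chosen for each member of the chain gives an independent set of the same
  size. The empty chain is split off because \<open>Fset_chain_independent\<close> concerns nonempty
  sets.\<close>

lemma Fset_chain_card:
  assumes r: "r_ind \<Gamma> \<Sigma> = enat n" and fin: "finite \<C>" and sub: "\<C> \<subseteq> Fset \<Gamma> D ` \<Sigma>"
    and chain: "\<And>X Y. \<lbrakk>X \<in> \<C>; Y \<in> \<C>\<rbrakk> \<Longrightarrow> X \<subseteq> Y \<or> Y \<subseteq> X"
  shows "card \<C> \<le> n"
proof (cases "\<C> = {}")
  case False
  obtain T where T: "T \<subseteq> \<Sigma>" "inj_on (Fset \<Gamma> D) T" "\<C> = Fset \<Gamma> D ` T"
    using sub by (auto simp: subset_image_inj)
  have "finite T" using fin T by (simp add: finite_image_iff)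
  moreover have "\<not> tropically_dependent \<Gamma> T"
    using \<open>finite T\<close> False T chain by (intro Fset_chain_independent) auto
  ultimately have "enat (card T) \<le> r_ind \<Gamma> \<Sigma>"
    using T(1) unfolding r_ind_def by (intro SUP_upper) auto
  then show ?thesis using r T card_image by fastforce
qed simp

section \<open>The Baker-Norine condition\<close>

lemma divisor_meeting_components:
  assumes "A \<subseteq> E" "card A \<le> n"
  obtains D' where "D' \<in> divisors \<Gamma>" "effective D'" "degree D' = int n"
    "\<And>S. S \<in> A \<Longrightarrow> \<exists>p\<in>S. 0 < D' p"
proof -
  have "verts (graph \<Gamma>) \<noteq> {}"
    using \<Gamma> by (auto simp: metric_graph_def Digraph_Component.connected_def strongly_connected_def)
  then obtain p0 where p0: "p0 \<in> points \<Gamma>" by (auto simp: points_def)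
  have "\<forall>S\<in>E. \<exists>p. p \<in> S" using component_nonempty by blast
  then obtain f where f: "\<And>S. S \<in> E \<Longrightarrow> f S \<in> S" by metis
  have fin: "finite A" using finite_subset[OF assms(1) finite_components] .
  \<comment> \<open>One chosen point from each component in \<open>A\<close>, padded with copies of
    an arbitrary point \<open>p0\<close>, since the degree must be exactly \<open>n\<close>.\<close>
  define M where "M = image_mset f (mset_set A) + replicate_mset (n - card A) p0"
  have "set_mset M \<subseteq> points \<Gamma>"
  proof -
    have "f S \<in> points \<Gamma>" if "S \<in> A" for S using f[of S] that assms(1) Union_components by blast
    then show ?thesis using p0 fin by (auto simp: M_def split: if_splits)
  qed
  moreover have "supp (\<lambda>p. int (count M p)) = set_mset M" by (auto simp: supp_def)
  ultimately have "(\<lambda>p. int (count M p)) \<in> divisors \<Gamma>" by (simp add: divisors_def)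
  moreover have "degree (\<lambda>p. int (count M p)) = int n"
    unfolding degree_count using assms(2) by (simp add: M_def)
  moreover have "\<exists>p\<in>S. 0 < int (count M p)" if "S \<in> A" for S
  proof -
    have "f S \<in># M" using that fin by (simp add: M_def)
    then show ?thesis using f[of S] that assms(1) by auto
  qed
  ultimately show thesis using that[of "\<lambda>p. int (count M p)"] by (auto simp: effective_def)
qed

text \<open>Where \<open>D\<close> is \<open>0\<close> and \<open>D'\<close> is positive,
  effectivity forces \<open>pl_div\<close> to be positive, which is impossible at a
  minimizer.\<close>

lemma Fset_of_vanishing:
  assumes \<phi>: "\<phi> \<in> \<Sigma>" and eff: "effective (\<lambda>p. D p - D' p + pl_div \<Gamma> \<phi> p)"
    and S: "S \<in> E" "p \<in> S" "0 < D' p"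
  shows "S \<in> Fset \<Gamma> D \<phi>"
proof (rule ccontr)
  assume "S \<notin> Fset \<Gamma> D \<phi>"
  then have "p \<in> minimizers \<Gamma> \<phi>" using S by (auto simp: Fset_def E)
  then have "pl_div \<Gamma> \<phi> p \<le> 0"
    using pl_div_minimizer_nonpos[OF \<Gamma> Rmod_PL[OF series_Rmod[OF \<phi>]]] by blast
  moreover have "p \<notin> supp D" using S Union_components by blast
  moreover have "0 \<le> D p - D' p + pl_div \<Gamma> \<phi> p" using eff by (simp add: effective_def)
  ultimately show False using S(3) by (simp add: supp_def)
qed

text \<open>The maximum in \<open>r_BN\<close> must first be seen to be attained. The condition
  holds vacuously in degree \<open>- 1\<close>, and it fails above \<open>card E\<close>, where a
  single \<open>Fset\<close> would contain all of \<open>E\<close>.\<close>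

lemma Fset_cover:
  assumes r: "r_BN \<Gamma> D \<Sigma> = int r" and A: "A \<subseteq> E" "card A \<le> r"
  shows "\<exists>\<phi>\<in>\<Sigma>. A \<subseteq> Fset \<Gamma> D \<phi>"
proof -
  define P where "P k \<longleftrightarrow> (\<forall>D'\<in>divisors \<Gamma>. effective D' \<and> degree D' = k \<longrightarrow>
    (\<exists>\<phi>\<in>\<Sigma>. effective (\<lambda>p. D p - D' p + pl_div \<Gamma> \<phi> p)))" for k
  have cover: "\<exists>\<phi>\<in>\<Sigma>. B \<subseteq> Fset \<Gamma> D \<phi>" if n: "P (int n)" and B: "B \<subseteq> E" "card B \<le> n" for B n
  proof -
    obtain D' where D': "D' \<in> divisors \<Gamma>" "effective D'" "degree D' = int n"
      "\<And>S. S \<in> B \<Longrightarrow> \<exists>p\<in>S. 0 < D' p"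
      using divisor_meeting_components[OF B] by blast
    then obtain \<phi> where "\<phi> \<in> \<Sigma>" "effective (\<lambda>p. D p - D' p + pl_div \<Gamma> \<phi> p)"
      using n unfolding P_def by blast
    then show ?thesis using Fset_of_vanishing[of \<phi> D'] D'(4) B(1) by blast
  qed
  have bound: "k \<le> int (card E)" if "P k" for k
  proof (rule ccontr)
    assume "\<not> k \<le> int (card E)"
    then obtain n where n: "k = int n" "card E \<le> n"
      using that[of "nat k"] by auto
    then show False using cover[of n E] that Fset_proper by blast
  qed
  have base: "P (- 1)"
  proof -
    have "0 \<le> degree D'" if "effective D'" for D' :: "('v, 'e) gpoint \<Rightarrow> int"
      using that by (simp add: degree_def effective_def sum_nonneg)
    then show ?thesis by (force simp: P_def)
  qed
  have "Greatest P = int r" using r by (simp add: r_BN_def P_def[abs_def])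
  then have "P (int r)" using Greatest_int[of P, OF base bound] by simp
  then show ?thesis using cover A by blast
qed

section \<open>Trivial divisors and the empty flat\<close>

lemma constant_off_supp_pl_div:
  assumes \<phi>: "\<phi> \<in> PL \<Gamma>" and const: "\<And>p. p \<in> points \<Gamma> - supp D \<Longrightarrow> \<phi> p = c"
  shows "pl_div \<Gamma> \<phi> p = 0"
proof -
  have "outgoing_slope \<Gamma> \<phi> d = 0" if d: "d \<in> tangents \<Gamma> p" for d
  proof -
    obtain e t \<sigma> where d': "d = (e, t, \<sigma>)" using prod_cases3 by blast
    note tan = tangentsD[OF d[unfolded d']]
    \<comment> \<open>The ends of the edge are included, so that near \<open>p\<close> the points
      along the direction are inner points off \<open>supp D\<close>.\<close>
    define B where "B = {0, len \<Gamma> e} \<union> {s. Inner e s \<in> supp D}"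
    have "finite B" using finite_inner_parameters[OF D] by (simp add: B_def)
    moreover have "\<forall>\<^sub>F h in at_right 0. t + \<sigma> * h \<noteq> s" for s
      using eventually_neq_at_within[of "(s - t) / \<sigma>" 0 "{0<..}"]
      by eventually_elim (use tan(4) in \<open>auto simp: field_simps\<close>)
    ultimately have off: "\<forall>\<^sub>F h in at_right 0. \<forall>s\<in>B. t + \<sigma> * h \<noteq> s"
      by (intro eventually_ball_finite) auto
    have "((\<lambda>h. t + \<sigma> * h) \<longlongrightarrow> t + \<sigma> * 0) (at_right 0)" by (intro tendsto_intros)
    then have lim: "((\<lambda>h. t + \<sigma> * h) \<longlongrightarrow> t) (at_right 0)" by simp
    have "\<forall>\<^sub>F h :: real in at_right 0. t + \<sigma> * h \<in> {0..len \<Gamma> e}"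
      using tan(4)
    proof
      assume \<sigma>: "\<sigma> = 1 \<and> t < len \<Gamma> e"
      then have "\<forall>\<^sub>F h in at_right 0. t + \<sigma> * h < len \<Gamma> e" using lim order_tendstoD(2) by blast
      then show ?thesis using eventually_at_right_less[of 0]
        by eventually_elim (use \<sigma> tan(2) in auto)
    next
      assume \<sigma>: "\<sigma> = -1 \<and> 0 < t"
      then have "\<forall>\<^sub>F h in at_right 0. 0 < t + \<sigma> * h" using lim order_tendstoD(1) by blast
      then show ?thesis using eventually_at_right_less[of 0]
        by eventually_elim (use \<sigma> tan(2) in auto)
    qed
    with off have "\<forall>\<^sub>F h in at_right 0. \<phi> (edge_pt \<Gamma> e (t + \<sigma> * h)) = c"
    proof eventually_elim
      case (elim h)
      then have "edge_pt \<Gamma> e (t + \<sigma> * h) = Inner e (t + \<sigma> * h)"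
        by (auto simp: edge_pt_def B_def)
      then show ?case
        using elim edge_pt_in_points[OF \<Gamma> tan(1), of "t + \<sigma> * h"] by (intro const) (auto simp: B_def)
    qed
    then have ev: "\<forall>\<^sub>F h in at_right 0. \<phi> p + of_int (outgoing_slope \<Gamma> \<phi> d) * h = c"
      using outgoing_slope[OF \<Gamma> \<phi> d[unfolded d']] unfolding d' by eventually_elim simp
    \<comment> \<open>Letting \<open>h\<close> tend to \<open>0\<close> gives
      \<open>\<phi> p = c\<close> also when \<open>p\<close> lies in \<open>supp D\<close>, and then
      the slope must vanish.\<close>
    have "((\<lambda>h. \<phi> p + of_int (outgoing_slope \<Gamma> \<phi> d) * h) \<longlongrightarrow>
        \<phi> p + of_int (outgoing_slope \<Gamma> \<phi> d) * 0) (at_right 0)" by (intro tendsto_intros)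
    moreover have "((\<lambda>h. \<phi> p + of_int (outgoing_slope \<Gamma> \<phi> d) * h) \<longlongrightarrow> c) (at_right 0)"
      by (rule tendsto_eventually[OF ev])
    ultimately have "\<phi> p = c" using tendsto_unique[of "at_right (0::real)"] by fastforce
    then have "\<forall>\<^sub>F h in at_right 0. of_int (outgoing_slope \<Gamma> \<phi> d) * h = (0 :: real)"
      using ev by simp
    then show ?thesis using eventually_linear_zero of_int_eq_0_iff by blast
  qed
  then show ?thesis by (simp add: pl_div_def)
qed

text \<open>If all components consist of minimizers, \<open>\<phi>\<close> is constant off
  \<open>supp D\<close>. Conversely, a function with trivial divisor lies in \<open>Rmod\<close> of
  the zero divisor, and the minimum principle on the connected graph makes it constant.\<close>

lemma Fset_empty_iff:
  assumes \<phi>: "\<phi> \<in> \<Sigma>"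
  shows "Fset \<Gamma> D \<phi> = {} \<longleftrightarrow> (\<forall>p. pl_div \<Gamma> \<phi> p = 0)"
proof
  assume "Fset \<Gamma> D \<phi> = {}"
  then have "\<Union>E \<subseteq> minimizers \<Gamma> \<phi>" by (auto simp: Fset_def E)
  moreover obtain q where "q \<in> minimizers \<Gamma> \<phi>" using minimizer_exists[OF \<phi>] by blast
  ultimately have "\<phi> p = \<phi> q" if "p \<in> points \<Gamma> - supp D" for p
    using that Union_components by (fastforce simp: minimizers_def)
  then show "\<forall>p. pl_div \<Gamma> \<phi> p = 0"
    using constant_off_supp_pl_div Rmod_PL[OF series_Rmod[OF \<phi>]] by blast
next
  assume "\<forall>p. pl_div \<Gamma> \<phi> p = 0"
  then have "\<phi> \<in> Rmod \<Gamma> (\<lambda>_. 0)"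
    using Rmod_PL[OF series_Rmod[OF \<phi>]] by (simp add: Rmod_def effective_def)
  moreover have "(\<lambda>_. 0) \<in> divisors \<Gamma>" by (simp add: divisors_def supp_def)
  moreover have "connectedin (gtopology \<Gamma>) (points \<Gamma>)"
    using connected_space_gtopology[OF \<Gamma>] connectedin_topspace topspace_gtopology[OF \<Gamma>] by metis
  ultimately have "points \<Gamma> \<subseteq> minimizers \<Gamma> \<phi> \<or> points \<Gamma> \<inter> minimizers \<Gamma> \<phi> = {}"
    using minimum_principle[OF \<Gamma>, of "\<lambda>_. 0" \<phi> "points \<Gamma>"] by (simp add: supp_def)
  moreover obtain q where "q \<in> minimizers \<Gamma> \<phi>" using minimizer_exists[OF \<phi>] by blast
  ultimately have "points \<Gamma> \<subseteq> minimizers \<Gamma> \<phi>" by (auto simp: minimizers_def)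
  then have "\<Union>E \<subseteq> minimizers \<Gamma> \<phi>" using Union_components by blast
  then show "Fset \<Gamma> D \<phi> = {}" by (auto simp: Fset_def E)
qed

lemma linear_system_iff: "D \<in> linear_system \<Gamma> D \<Sigma> \<longleftrightarrow> {} \<in> Fset \<Gamma> D ` \<Sigma>"
proof -
  have "D \<in> linear_system \<Gamma> D \<Sigma> \<longleftrightarrow> (\<exists>\<phi>\<in>\<Sigma>. \<forall>p. pl_div \<Gamma> \<phi> p = 0)"
    by (auto simp: linear_system_def fun_eq_iff image_iff)
  then show ?thesis using Fset_empty_iff by (auto simp: image_iff)
qed

end

theorem theorem4p5:
  fixes \<Gamma> :: "('v, 'e) mgraph"
    and D :: "('v, 'e) gpoint \<Rightarrow> int"
    and E :: "('v, 'e) gpoint set set"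
    and \<Sigma> :: "(('v, 'e) gpoint \<Rightarrow> real) set"
    and r :: nat
  assumes "metric_graph \<Gamma>"
    and "D \<in> divisors \<Gamma>" and "effective D"
    and "E = supp_complement_components \<Gamma> D"
    and "tropical_linear_series \<Gamma> D r \<Sigma>"
    and "big_minimizers \<Gamma> D \<Sigma>"
  shows "\<exists>Ind. matroid E Ind \<and> matroid_rank Ind E = r + 1 \<and>
           flats E Ind = {Fset \<Gamma> D \<phi> | \<phi>. \<phi> \<in> \<Sigma>} \<union> {E} \<and>
           (loopless E Ind \<longleftrightarrow> D \<in> linear_system \<Gamma> D \<Sigma>)"
proof -
  interpret M: big_minimizers_module \<Gamma> D \<Sigma> E
    using assms by unfold_locales (auto simp: tropical_linear_series_def)
  have r: "r_BN \<Gamma> D \<Sigma> = int r" "r_ind \<Gamma> \<Sigma> = enat (r + 1)"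
    using assms(5) by (auto simp: tropical_linear_series_def)
  interpret F: graded_intersection_family E "Fset \<Gamma> D ` \<Sigma>" r
  proof
    show "\<exists>F\<in>Fset \<Gamma> D ` \<Sigma>. A \<subseteq> F" if "A \<subseteq> E" "card A \<le> r" for A
      using M.Fset_cover[OF r(1) that] by blast
    show "card \<C> \<le> r + 1"
      if "finite \<C>" "\<C> \<subseteq> Fset \<Gamma> D ` \<Sigma>" "\<And>X Y. \<lbrakk>X \<in> \<C>; Y \<in> \<C>\<rbrakk> \<Longrightarrow> X \<subseteq> Y \<or> Y \<subseteq> X" for \<C>
      using M.Fset_chain_card[OF r(2) that] .
    show "F \<inter> G \<in> Fset \<Gamma> D ` \<Sigma>" if F: "F \<in> Fset \<Gamma> D ` \<Sigma>" and G: "G \<in> Fset \<Gamma> D ` \<Sigma>" for F G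
    proof -
      obtain \<phi> \<psi> where "\<phi> \<in> \<Sigma>" "F = Fset \<Gamma> D \<phi>" "\<psi> \<in> \<Sigma>" "G = Fset \<Gamma> D \<psi>"
        using F G by blast
      then show ?thesis using M.Fset_Int[of \<phi> \<psi>] by auto
    qed
    show "F \<subset> E" if "F \<in> Fset \<Gamma> D ` \<Sigma>" for F using that M.Fset_proper by blast
  qed (rule M.finite_components)
  have "flats E F.indep = {Fset \<Gamma> D \<phi> | \<phi>. \<phi> \<in> \<Sigma>} \<union> {E}"
    by (simp add: F.flats_indep Setcompr_eq_image)
  moreover have "loopless E F.indep \<longleftrightarrow> D \<in> linear_system \<Gamma> D \<Sigma>"
    by (simp only: F.loopless_indep M.linear_system_iff)
  ultimately show ?thesis using F.matroid_indep F.rank_indep by blast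
qed

end
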